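(* $i{\sf RCA}_0^\omega$ cannot prove ${\sf RT}(2,4)$ with one typical use of ${\sf RT}(2,2)$, where for $k\in\{2,4\}$, ${\sf RT}(2,k)$ is formalized as \[\forall f\,\bigl(0=0\to\exists x\,\forall m\,(x(m)<x(m+1)\land\forall i,j\,(0<i<j<m\to t_k(f(x(i),x(j)))=x(0)))\bigr),\] with $f,x$ type-1 variables.
   Context: ${\sf RCA}_0^\omega$ is Kohlenbach's higher-order base system: $\widehat{\mathsf{E}\text{-}\mathsf{HA}}^\omega_{\upharpoonright}$ plus the law of the excluded middle plus ${\sf QF}\text{-}{\sf AC}^{1,0}$; $i{\sf RCA}_0^\omega$ is this system without the law of the excluded middle. Pairs of numbers are coded by single numbers, so a type-1 function $f$ is viewed as a function on $[\mathbb{N}]^2$; $t_k(m)=m$ if $m<k$ and $t_k(m)=0$ otherwise. A theory $\mathcal{T}$ proves ${\sf Q}:\forall u\,(q_1(u)\to\exists v\,q_2(u,v))$ with one typical use of ${\sf P}:\forall x\,(p_1(x)\to\exists y\,p_2(x,y))$ if: (i) for a variable $u$ there is a term $x_u$ such that from axioms of $\mathcal{T}$ and the assumption $q_1(u)$, with no generalization on $u$ or variables free in $x_u$, there is a deduction of $p_1(x_u)$; and (ii) for a fresh constant $y_0$ there is a term $v_{x_u,y_0}$ such that from axioms of $\mathcal{T}$ and the assumption $p_2(x_u,y_0)$, with no generalization on $u$ or variables free in $x_u$ or $v_{x_u,y_0}$, there is a deduction of $q_2(u,v_{x_u,y_0})$. *)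

theory Defs
  imports Main
begin

section \<open>The language of finite types\<close>

text \<open>\<open>Nt\<close> is the type 0 of the natural numbers, \<open>Fn \<rho> \<tau>\<close> the type of functionals from \<open>\<rho>\<close> to \<open>\<tau>\<close>.\<close>

datatype ty = Nt | Fn ty ty

abbreviation ty1 :: ty where "ty1 \<equiv> Fn Nt Nt"

type_synonym var = "nat \<times> ty"

text \<open>
  Locally nameless syntax: free variables are named and carry their type, bound variables are
  de Bruijn indices, so that formulas are identified up to renaming of bound variables and the
  substitution of terms without dangling indices never captures a variable.
  \<open>Cst \<tau>\<close> is a spare constant of type \<open>\<tau>\<close>. It does not belong to the language of the
  theories considered; it serves as the fresh constant in the definition of a typical use.
\<close>

datatype trm =
    Var var
  | Bnd nat
  | Cst ty
  | Zero
  | Succ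
  | PiC ty ty
  | SigC ty ty ty
  | Rec
  | App trm trm  (infixl "\<^bold>\<cdot>" 90)

datatype fm =
    Eq trm trm
  | Bot
  | And fm fm
  | Or fm fm
  | Imp fm fm
  | AllB ty fm
  | ExB ty fm

fun tyof :: "ty list \<Rightarrow> trm \<Rightarrow> ty option" where
  "tyof \<Delta> (Var x) = Some (snd x)"
| "tyof \<Delta> (Bnd n) = (if n < length \<Delta> then Some (\<Delta> ! n) else None)"
| "tyof \<Delta> (Cst \<tau>) = Some \<tau>"
| "tyof \<Delta> Zero = Some Nt"
| "tyof \<Delta> Succ = Some ty1"
| "tyof \<Delta> (PiC \<rho> \<tau>) = Some (Fn \<rho> (Fn \<tau> \<rho>))"
| "tyof \<Delta> (SigC \<delta> \<rho> \<tau>) = Some (Fn (Fn \<delta> (Fn \<rho> \<tau>)) (Fn (Fn \<delta> \<rho>) (Fn \<delta> \<tau>)))"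
| "tyof \<Delta> Rec = Some (Fn Nt (Fn Nt (Fn (Fn Nt (Fn Nt Nt)) Nt)))"
| "tyof \<Delta> (s \<^bold>\<cdot> t) = (case tyof \<Delta> s of
      Some (Fn \<rho> \<tau>) \<Rightarrow> (if tyof \<Delta> t = Some \<rho> then Some \<tau> else None)
    | _ \<Rightarrow> None)"

fun csts :: "trm \<Rightarrow> ty set" where
  "csts (Cst \<tau>) = {\<tau>}"
| "csts (s \<^bold>\<cdot> t) = csts s \<union> csts t"
| "csts _ = {}"

text \<open>
  Well-typed terms and formulas over the language enlarged by the constants \<open>Cst \<tau>\<close> with
  \<open>\<tau> \<in> C\<close>; the list \<open>\<Delta>\<close> gives the types of the dangling indices.
\<close>

definition wt :: "ty set \<Rightarrow> ty list \<Rightarrow> trm \<Rightarrow> ty \<Rightarrow> bool" where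
  "wt C \<Delta> t \<tau> \<longleftrightarrow> tyof \<Delta> t = Some \<tau> \<and> csts t \<subseteq> C"

fun wff :: "ty set \<Rightarrow> ty list \<Rightarrow> fm \<Rightarrow> bool" where
  "wff C \<Delta> (Eq s t) \<longleftrightarrow> wt C \<Delta> s Nt \<and> wt C \<Delta> t Nt"
| "wff C \<Delta> Bot \<longleftrightarrow> True"
| "wff C \<Delta> (And A B) \<longleftrightarrow> wff C \<Delta> A \<and> wff C \<Delta> B"
| "wff C \<Delta> (Or A B) \<longleftrightarrow> wff C \<Delta> A \<and> wff C \<Delta> B"
| "wff C \<Delta> (Imp A B) \<longleftrightarrow> wff C \<Delta> A \<and> wff C \<Delta> B"
| "wff C \<Delta> (AllB \<tau> A) \<longleftrightarrow> wff C (\<tau> # \<Delta>) A"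
| "wff C \<Delta> (ExB \<tau> A) \<longleftrightarrow> wff C (\<tau> # \<Delta>) A"

fun fv :: "trm \<Rightarrow> var set" where
  "fv (Var x) = {x}"
| "fv (s \<^bold>\<cdot> t) = fv s \<union> fv t"
| "fv _ = {}"

fun fvf :: "fm \<Rightarrow> var set" where
  "fvf (Eq s t) = fv s \<union> fv t"
| "fvf Bot = {}"
| "fvf (And A B) = fvf A \<union> fvf B"
| "fvf (Or A B) = fvf A \<union> fvf B"
| "fvf (Imp A B) = fvf A \<union> fvf B"
| "fvf (AllB \<tau> A) = fvf A"
| "fvf (ExB \<tau> A) = fvf A"

fun qfree :: "fm \<Rightarrow> bool" where
  "qfree (Eq s t) \<longleftrightarrow> True"
| "qfree Bot \<longleftrightarrow> True"
| "qfree (And A B) \<longleftrightarrow> qfree A \<and> qfree B"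
| "qfree (Or A B) \<longleftrightarrow> qfree A \<and> qfree B"
| "qfree (Imp A B) \<longleftrightarrow> qfree A \<and> qfree B"
| "qfree (AllB \<tau> A) \<longleftrightarrow> False"
| "qfree (ExB \<tau> A) \<longleftrightarrow> False"

fun substt :: "var \<Rightarrow> trm \<Rightarrow> trm \<Rightarrow> trm" where
  "substt x r (Var y) = (if y = x then r else Var y)"
| "substt x r (s \<^bold>\<cdot> t) = substt x r s \<^bold>\<cdot> substt x r t"
| "substt x r t = t"

text \<open>Correct only for terms \<open>r\<close> without dangling indices, the only ones it is used with.\<close>

fun subst :: "var \<Rightarrow> trm \<Rightarrow> fm \<Rightarrow> fm" where
  "subst x r (Eq s t) = Eq (substt x r s) (substt x r t)"
| "subst x r Bot = Bot"
| "subst x r (And A B) = And (subst x r A) (subst x r B)"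
| "subst x r (Or A B) = Or (subst x r A) (subst x r B)"
| "subst x r (Imp A B) = Imp (subst x r A) (subst x r B)"
| "subst x r (AllB \<tau> A) = AllB \<tau> (subst x r A)"
| "subst x r (ExB \<tau> A) = ExB \<tau> (subst x r A)"

text \<open>Replacing a named variable by an index, which yields the usual named quantifiers.\<close>

fun bindt :: "nat \<Rightarrow> var \<Rightarrow> trm \<Rightarrow> trm" where
  "bindt k x (Var y) = (if y = x then Bnd k else Var y)"
| "bindt k x (s \<^bold>\<cdot> t) = bindt k x s \<^bold>\<cdot> bindt k x t"
| "bindt k x t = t"

fun bind :: "nat \<Rightarrow> var \<Rightarrow> fm \<Rightarrow> fm" where
  "bind k x (Eq s t) = Eq (bindt k x s) (bindt k x t)"
| "bind k x Bot = Bot"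
| "bind k x (And A B) = And (bind k x A) (bind k x B)"
| "bind k x (Or A B) = Or (bind k x A) (bind k x B)"
| "bind k x (Imp A B) = Imp (bind k x A) (bind k x B)"
| "bind k x (AllB \<tau> A) = AllB \<tau> (bind (Suc k) x A)"
| "bind k x (ExB \<tau> A) = ExB \<tau> (bind (Suc k) x A)"

definition Forall :: "var \<Rightarrow> fm \<Rightarrow> fm" where
  "Forall x A = AllB (snd x) (bind 0 x A)"

definition Exists :: "var \<Rightarrow> fm \<Rightarrow> fm" where
  "Exists x A = ExB (snd x) (bind 0 x A)"

text \<open>
  Equality is primitive at type 0 only; at the type \<open>\<rho>\<^sub>1 \<rightarrow> \<dots> \<rightarrow> \<rho>\<^sub>n \<rightarrow> 0\<close> it abbreviates
  \<open>\<forall>y\<^sub>1 \<dots> y\<^sub>n. s y\<^sub>1 \<dots> y\<^sub>n = t y\<^sub>1 \<dots> y\<^sub>n\<close>.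
\<close>

fun lift :: "trm \<Rightarrow> trm" where
  "lift (Bnd n) = Bnd (Suc n)"
| "lift (s \<^bold>\<cdot> t) = lift s \<^bold>\<cdot> lift t"
| "lift t = t"

fun eqt :: "ty \<Rightarrow> trm \<Rightarrow> trm \<Rightarrow> fm" where
  "eqt Nt s t = Eq s t"
| "eqt (Fn \<rho> \<tau>) s t = AllB \<rho> (eqt \<tau> (lift s \<^bold>\<cdot> Bnd 0) (lift t \<^bold>\<cdot> Bnd 0))"

section \<open>Deductions in intuitionistic predicate logic\<close>

inductive logical_axiom :: "fm \<Rightarrow> bool" where
  "logical_axiom (Imp A (Imp B A))"
| "logical_axiom (Imp (Imp A (Imp B D)) (Imp (Imp A B) (Imp A D)))"
| "logical_axiom (Imp A (Imp B (And A B)))"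
| "logical_axiom (Imp (And A B) A)"
| "logical_axiom (Imp (And A B) B)"
| "logical_axiom (Imp A (Or A B))"
| "logical_axiom (Imp B (Or A B))"
| "logical_axiom (Imp (Imp A D) (Imp (Imp B D) (Imp (Or A B) D)))"
| "logical_axiom (Imp Bot A)"
| "wt UNIV [] t (snd x) \<Longrightarrow> logical_axiom (Imp (Forall x A) (subst x t A))"
| "wt UNIV [] t (snd x) \<Longrightarrow> logical_axiom (Imp (subst x t A) (Exists x A))"
| "x \<notin> fvf B \<Longrightarrow> logical_axiom (Imp (Forall x (Imp B A)) (Imp B (Forall x A)))"
| "x \<notin> fvf B \<Longrightarrow> logical_axiom (Imp (Forall x (Imp A B)) (Imp (Exists x A) B))"

text \<open>
  \<open>deduces T C G \<Gamma> A\<close>: in the language enlarged by the constants from \<open>C\<close>, there is a deduction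
  of \<open>A\<close> from the axioms \<open>T\<close> and the assumptions \<open>\<Gamma>\<close> that nowhere generalizes on a variable
  from \<open>G\<close>. Theories are given by all instances of their axioms in the language with all spare
  constants, of which a deduction may use those in its own language.
\<close>

inductive deduces :: "fm set \<Rightarrow> ty set \<Rightarrow> var set \<Rightarrow> fm set \<Rightarrow> fm \<Rightarrow> bool"
  for T :: "fm set" and C :: "ty set" and G :: "var set" and \<Gamma> :: "fm set" where
  Logical: "logical_axiom A \<Longrightarrow> wff C [] A \<Longrightarrow> deduces T C G \<Gamma> A"
| Axiom: "A \<in> T \<Longrightarrow> wff C [] A \<Longrightarrow> deduces T C G \<Gamma> A"
| Assumption: "A \<in> \<Gamma> \<Longrightarrow> wff C [] A \<Longrightarrow> deduces T C G \<Gamma> A"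
| MP: "deduces T C G \<Gamma> (Imp A B) \<Longrightarrow> deduces T C G \<Gamma> A \<Longrightarrow> deduces T C G \<Gamma> B"
| Gen: "deduces T C G \<Gamma> A \<Longrightarrow> x \<notin> G \<Longrightarrow> deduces T C G \<Gamma> (Forall x A)"

section \<open>The theory iRCA\<open>\<^sub>0\<^sup>\<omega>\<close>\<close>

text \<open>
  All axioms but the last are those of the extensional intuitionistic arithmetic in all finite
  types with the recursor of type 0 and quantifier-free induction only; the last one is the
  schema \<open>QF-AC\<^sup>1\<^sup>,\<^sup>0\<close>. The excluded middle is not included.
\<close>

inductive_set iRCA0\<omega> :: "fm set" where
  eq_refl: "Eq t t \<in> iRCA0\<omega>"
| eq_sym: "Imp (Eq s t) (Eq t s) \<in> iRCA0\<omega>"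
| eq_trans: "Imp (And (Eq r s) (Eq s t)) (Eq r t) \<in> iRCA0\<omega>"
| extensionality:
    "wt UNIV [] r (Fn \<rho> \<tau>) \<Longrightarrow> wt UNIV [] s \<rho> \<Longrightarrow> wt UNIV [] t \<rho> \<Longrightarrow>
     Imp (eqt \<rho> s t) (eqt \<tau> (r \<^bold>\<cdot> s) (r \<^bold>\<cdot> t)) \<in> iRCA0\<omega>"
| succ_neq_zero: "Imp (Eq (Succ \<^bold>\<cdot> t) Zero) Bot \<in> iRCA0\<omega>"
| succ_inject: "Imp (Eq (Succ \<^bold>\<cdot> s) (Succ \<^bold>\<cdot> t)) (Eq s t) \<in> iRCA0\<omega>"
| projector:
    "wt UNIV [] s \<rho> \<Longrightarrow> wt UNIV [] t \<tau> \<Longrightarrow> eqt \<rho> (PiC \<rho> \<tau> \<^bold>\<cdot> s \<^bold>\<cdot> t) s \<in> iRCA0\<omega>"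
| combinator:
    "wt UNIV [] r (Fn \<delta> (Fn \<rho> \<tau>)) \<Longrightarrow> wt UNIV [] s (Fn \<delta> \<rho>) \<Longrightarrow> wt UNIV [] t \<delta> \<Longrightarrow>
     eqt \<tau> (SigC \<delta> \<rho> \<tau> \<^bold>\<cdot> r \<^bold>\<cdot> s \<^bold>\<cdot> t) (r \<^bold>\<cdot> t \<^bold>\<cdot> (s \<^bold>\<cdot> t)) \<in> iRCA0\<omega>"
| rec_zero: "Eq (Rec \<^bold>\<cdot> Zero \<^bold>\<cdot> s \<^bold>\<cdot> t) s \<in> iRCA0\<omega>"
| rec_succ: "Eq (Rec \<^bold>\<cdot> (Succ \<^bold>\<cdot> r) \<^bold>\<cdot> s \<^bold>\<cdot> t) (t \<^bold>\<cdot> (Rec \<^bold>\<cdot> r \<^bold>\<cdot> s \<^bold>\<cdot> t) \<^bold>\<cdot> r) \<in> iRCA0\<omega>"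
| qf_induction:
    "qfree A \<Longrightarrow> wff UNIV [] A \<Longrightarrow> snd x = Nt \<Longrightarrow>
     Imp (And (subst x Zero A) (Forall x (Imp A (subst x (Succ \<^bold>\<cdot> Var x) A)))) (Forall x A) \<in> iRCA0\<omega>"
| qf_choice:
    "qfree A \<Longrightarrow> wff UNIV [] A \<Longrightarrow> snd x = ty1 \<Longrightarrow> snd y = Nt \<Longrightarrow> snd z = Fn ty1 Nt \<Longrightarrow>
     z \<notin> fvf A \<Longrightarrow>
     Imp (Forall x (Exists y A)) (Exists z (Forall x (subst y (Var z \<^bold>\<cdot> Var x) A))) \<in> iRCA0\<omega>"

section \<open>One typical use\<close>

text \<open>
  \<open>T\<close> proves \<open>Q = \<forall>u (q\<^sub>1(u) \<rightarrow> \<exists>v q\<^sub>2(u,v))\<close> with one typical use of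
  \<open>P = \<forall>x (p\<^sub>1(x) \<rightarrow> \<exists>y p\<^sub>2(x,y))\<close>. The terms \<open>r\<close> and \<open>s\<close> are \<open>x\<^sub>u\<close> and \<open>v\<^bsub>x\<^sub>u,y\<^sub>0\<^esub>\<close>; the fresh
  constant \<open>y\<^sub>0\<close> is available in the second deduction and in \<open>s\<close> only.
\<close>

definition one_typical_use :: "fm set \<Rightarrow> fm \<Rightarrow> fm \<Rightarrow> bool" where
  "one_typical_use T Q P \<longleftrightarrow>
    (\<exists>u v q1 q2 x y p1 p2 r s.
       wff {} [] q1 \<and> wff {} [] q2 \<and> u \<noteq> v \<and> Q = Forall u (Imp q1 (Exists v q2)) \<and>
       wff {} [] p1 \<and> wff {} [] p2 \<and> x \<noteq> y \<and> P = Forall x (Imp p1 (Exists y p2)) \<and>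
       wt {} [] r (snd x) \<and>
       deduces T {} ({u} \<union> fv r) {q1} (subst x r p1) \<and>
       wt {snd y} [] s (snd v) \<and>
       deduces T {snd y} ({u} \<union> fv r \<union> fv s)
         {subst x r (subst y (Cst (snd y)) p2)} (subst v s q2))"

section \<open>Ramsey's theorem for pairs\<close>

text \<open>Bracket abstraction: \<open>lam x t\<close> applied to \<open>s\<close> is provably equal to \<open>t\<close> with \<open>s\<close> for \<open>x\<close>.\<close>

fun lam :: "var \<Rightarrow> trm \<Rightarrow> trm" where
  "lam x (Var y) =
     (if y = x
      then SigC (snd x) (Fn (snd x) (snd x)) (snd x)
             \<^bold>\<cdot> PiC (snd x) (Fn (snd x) (snd x)) \<^bold>\<cdot> PiC (snd x) (snd x)
      else PiC (snd y) (snd x) \<^bold>\<cdot> Var y)"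
| "lam x (s \<^bold>\<cdot> t) =
     SigC (snd x) (the (tyof [] t)) (the (tyof [] (s \<^bold>\<cdot> t))) \<^bold>\<cdot> lam x s \<^bold>\<cdot> lam x t"
| "lam x t = PiC (the (tyof [] t)) (snd x) \<^bold>\<cdot> t"

abbreviation va :: var where "va \<equiv> (0, Nt)"
abbreviation vb :: var where "vb \<equiv> (1, Nt)"
abbreviation vp :: var where "vp \<equiv> (2, Nt)"
abbreviation vq :: var where "vq \<equiv> (3, Nt)"

text \<open>\<open>Rec a b c\<close> is \<open>b\<close> for \<open>a = 0\<close> and \<open>c (Rec a' b c) a'\<close> for \<open>a = a' + 1\<close>.\<close>

definition plus_t :: trm where
  "plus_t = lam va (lam vb (Rec \<^bold>\<cdot> Var vb \<^bold>\<cdot> Var va \<^bold>\<cdot> lam vp (lam vq (Succ \<^bold>\<cdot> Var vp))))"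

definition pred_t :: trm where
  "pred_t = lam va (Rec \<^bold>\<cdot> Var va \<^bold>\<cdot> Zero \<^bold>\<cdot> lam vp (lam vq (Var vq)))"

definition monus_t :: trm where
  "monus_t = lam va (lam vb (Rec \<^bold>\<cdot> Var vb \<^bold>\<cdot> Var va \<^bold>\<cdot> lam vp (lam vq (pred_t \<^bold>\<cdot> Var vp))))"

text \<open>The triangular numbers \<open>0 + 1 + \<dots> + a\<close>.\<close>

definition tri_t :: trm where
  "tri_t = lam va (Rec \<^bold>\<cdot> Var va \<^bold>\<cdot> Zero
                     \<^bold>\<cdot> lam vp (lam vq (plus_t \<^bold>\<cdot> Var vp \<^bold>\<cdot> (Succ \<^bold>\<cdot> Var vq))))"

text \<open>Cantor's coding of pairs: the sum of \<open>a\<close> and the triangular number of \<open>a + b\<close>.\<close>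

definition pair_t :: trm where
  "pair_t = lam va (lam vb (plus_t \<^bold>\<cdot> (tri_t \<^bold>\<cdot> (plus_t \<^bold>\<cdot> Var va \<^bold>\<cdot> Var vb)) \<^bold>\<cdot> Var va))"

fun numeral_t :: "nat \<Rightarrow> trm" where
  "numeral_t 0 = Zero"
| "numeral_t (Suc n) = Succ \<^bold>\<cdot> numeral_t n"

text \<open>The truncation \<open>t\<^sub>k\<close>, by cases on whether the cut-off difference of \<open>k\<close> and \<open>a\<close> is 0.\<close>

definition trunc_t :: "nat \<Rightarrow> trm" where
  "trunc_t k = lam va (Rec \<^bold>\<cdot> (monus_t \<^bold>\<cdot> numeral_t k \<^bold>\<cdot> Var va) \<^bold>\<cdot> Zero
                         \<^bold>\<cdot> lam vp (lam vq (Var va)))"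

definition Lt :: "trm \<Rightarrow> trm \<Rightarrow> fm" where
  "Lt s t = Eq (monus_t \<^bold>\<cdot> (Succ \<^bold>\<cdot> s) \<^bold>\<cdot> t) Zero"

text \<open>The value \<open>x(0)\<close> is the colour, the values \<open>x(1), x(2), \<dots>\<close> enumerate the homogeneous set.\<close>

definition RT2 :: "nat \<Rightarrow> fm" where
  "RT2 k = (let f = (0, ty1); x = (1, ty1); m = (0, Nt); i = (1, Nt); j = (2, Nt) in
     Forall f (Imp (Eq Zero Zero) (Exists x (Forall m
       (And (Lt (Var x \<^bold>\<cdot> Var m) (Var x \<^bold>\<cdot> (Succ \<^bold>\<cdot> Var m)))
            (Forall i (Forall j
              (Imp (And (Lt Zero (Var i)) (And (Lt (Var i) (Var j)) (Lt (Var j) (Var m))))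
                   (Eq (trunc_t k \<^bold>\<cdot> (Var f \<^bold>\<cdot> (pair_t \<^bold>\<cdot> (Var x \<^bold>\<cdot> Var i) \<^bold>\<cdot> (Var x \<^bold>\<cdot> Var j))))
                       (Var x \<^bold>\<cdot> Zero))))))))))"

text \<open>The terms and formulas above are well typed, in the language without spare constants, and closed.\<close>

lemma tyof_App:
  "tyof \<Delta> (s \<^bold>\<cdot> t) = Some \<tau> \<longleftrightarrow> (\<exists>\<rho>. tyof \<Delta> s = Some (Fn \<rho> \<tau>) \<and> tyof \<Delta> t = Some \<rho>)"
  by (auto split: option.split ty.split)

lemma tyof_lam: "tyof [] t = Some \<tau> \<Longrightarrow> tyof \<Delta> (lam x t) = Some (Fn (snd x) \<tau>)"
proof (induction t arbitrary: \<tau>)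
  case (App s t)
  then obtain \<rho> where \<rho>: "tyof [] s = Some (Fn \<rho> \<tau>)" "tyof [] t = Some \<rho>"
    by (auto simp only: tyof_App)
  show ?case
    using App.IH(1)[OF \<rho>(1)] App.IH(2)[OF \<rho>(2)] \<rho> by simp
qed auto

lemma csts_lam: "csts (lam x t) = csts t"
  by (induction t) auto

lemma wt_lam: "wt C [] t \<tau> \<Longrightarrow> wt C \<Delta> (lam x t) (Fn (snd x) \<tau>)"
  by (simp add: wt_def tyof_lam csts_lam)

lemma fv_lam: "fv (lam x t) = fv t - {x}"
  by (induction t) auto

lemma bindt_fresh: "x \<notin> fv t \<Longrightarrow> bindt k x t = t"
  by (induction t) auto

lemma wt_App: "wt C \<Delta> s (Fn \<rho> \<tau>) \<Longrightarrow> wt C \<Delta> t \<rho> \<Longrightarrow> wt C \<Delta> (s \<^bold>\<cdot> t) \<tau>"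
  by (auto simp: wt_def)

lemma wt_atoms:
  "snd x = \<tau> \<Longrightarrow> wt C \<Delta> (Var x) \<tau>"
  "n < length \<Delta> \<Longrightarrow> \<Delta> ! n = \<tau> \<Longrightarrow> wt C \<Delta> (Bnd n) \<tau>"
  "wt C \<Delta> Zero Nt"
  "wt C \<Delta> Succ (Fn Nt Nt)"
  "wt C \<Delta> Rec (Fn Nt (Fn Nt (Fn (Fn Nt (Fn Nt Nt)) Nt)))"
  by (auto simp: wt_def)

lemma wt_numeral_t: "wt C \<Delta> (numeral_t k) Nt"
  by (induction k) (auto simp: wt_def)

lemma fv_numeral_t: "fv (numeral_t k) = {}"
  by (induction k) auto

lemma wt_lam_Nt: "wt C [] t \<tau> \<Longrightarrow> wt C \<Delta> (lam (n, Nt) t) (Fn Nt \<tau>)"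
  using wt_lam[of C t \<tau> \<Delta> "(n, Nt)"] by simp

lemmas wt_intros = wt_lam_Nt wt_App wt_atoms wt_numeral_t

lemma wt_plus_t: "wt C \<Delta> plus_t (Fn Nt (Fn Nt Nt))"
  unfolding plus_t_def by (rule wt_intros | simp)+

lemma wt_pred_t: "wt C \<Delta> pred_t (Fn Nt Nt)"
  unfolding pred_t_def by (rule wt_intros | simp)+

lemma wt_monus_t: "wt C \<Delta> monus_t (Fn Nt (Fn Nt Nt))"
  unfolding monus_t_def by (rule wt_intros wt_pred_t | simp)+

lemma wt_tri_t: "wt C \<Delta> tri_t (Fn Nt Nt)"
  unfolding tri_t_def by (rule wt_intros wt_plus_t | simp)+

lemma wt_pair_t: "wt C \<Delta> pair_t (Fn Nt (Fn Nt Nt))"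
  unfolding pair_t_def by (rule wt_plus_t wt_tri_t wt_intros | simp)+

lemma wt_trunc_t: "wt C \<Delta> (trunc_t k) (Fn Nt Nt)"
  unfolding trunc_t_def by (rule wt_monus_t wt_intros | simp)+

lemma fv_arith:
  "fv plus_t = {}" "fv pred_t = {}" "fv monus_t = {}" "fv tri_t = {}" "fv pair_t = {}"
  "fv (trunc_t k) = {}"
  by (auto simp: plus_t_def pred_t_def monus_t_def tri_t_def pair_t_def trunc_t_def
        fv_lam fv_numeral_t simp del: lam.simps)

lemma fvf_RT2: "fvf (RT2 k) = {}"
  by (simp add: RT2_def Forall_def Exists_def Lt_def Let_def bindt_fresh fv_arith)

lemma wff_RT2: "wff {} [] (RT2 k)"
proof -
  have *: "tyof \<Delta> monus_t = Some (Fn Nt (Fn Nt Nt))" "csts monus_t = {}"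
    "tyof \<Delta> pair_t = Some (Fn Nt (Fn Nt Nt))" "csts pair_t = {}"
    "tyof \<Delta> (trunc_t k) = Some (Fn Nt Nt)" "csts (trunc_t k) = {}" for \<Delta>
    using wt_monus_t[of "{}" \<Delta>] wt_pair_t[of "{}" \<Delta>] wt_trunc_t[of "{}" \<Delta> k]
    by (simp_all add: wt_def)
  show ?thesis
    by (simp add: RT2_def Forall_def Exists_def Lt_def Let_def bindt_fresh fv_arith wt_def *)
qed

end

theory Submission
  imports Defs "HOL-Library.Nat_Bijection" "HOL-Library.Infinite_Set"
begin

text \<open>
  The hereditarily total elements of Scott's graph model of sets of numbers form a classical model
  of the theory in which type 1 is the full Baire space and every functional is continuous. A
  typical use would therefore provide continuous \<open>F\<close> and \<open>S\<close> such that, whenever \<open>y\<close> is a solution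
  of the 2-colouring \<open>F f\<close>, the 4-colouring \<open>f\<close> has an infinite homogeneous set of colour \<open>S f y\<close>.

  Given \<open>f\<close>, let \<open>V\<close> be the lexicographic limes inferior of the rows \<open>\<lambda>a. F f (a, b)\<close> as
  \<open>b \<rightarrow> \<infinity>\<close>. For one of the two colours \<open>i\<close>, every finite \<open>i\<close>-homogeneous set of numbers \<open>a\<close> with
  \<open>V a = i\<close> extends to an infinite one. The first such finite set which, together with a finite part
  of \<open>f\<close>, determines the value of \<open>S\<close> gives a colour \<open>c\<^sub>i\<close> that some solution of \<open>F f\<close> is mapped to,
  and \<open>c\<^sub>i\<close> is a double limit \<open>lim\<^sub>x lim\<^sub>y\<close> of guesses that only look at \<open>f\<close> below \<open>y\<close>. Hence a
  colouring \<open>f\<close> can be defined by recursion such that \<open>f (x, y)\<close> differs from both guesses at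
  \<open>(x, y)\<close>, and this \<open>f\<close> has no infinite homogeneous set of colour \<open>c\<^sub>i\<close>.
\<close>

section \<open>Colours of homogeneous sets are not continuously reducible\<close>

definition trunc :: "nat \<Rightarrow> nat \<Rightarrow> nat" where
  "trunc k m = (if m < k then m else 0)"

definition homogeneous :: "nat \<Rightarrow> (nat \<Rightarrow> nat) \<Rightarrow> (nat \<Rightarrow> nat) \<Rightarrow> bool" where
  "homogeneous k f x \<longleftrightarrow> (\<forall>m. x m < x (Suc m) \<and>
     (\<forall>i j. 0 < i \<and> i < j \<and> j < m \<longrightarrow> trunc k (f (prod_encode (x i, x j))) = x 0))"

definition agree :: "nat \<Rightarrow> (nat \<Rightarrow> nat) \<Rightarrow> (nat \<Rightarrow> nat) \<Rightarrow> bool" where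
  "agree k f f' \<longleftrightarrow> (\<forall>i<k. f' i = f i)"

lemma agree_mono: "agree k f f' \<Longrightarrow> l \<le> k \<Longrightarrow> agree l f f'"
  by (auto simp: agree_def)

text \<open>Well-founded recursion applies \<open>\<Phi>\<close> to the cut of \<open>f\<close> at
  \<open>n\<close>, which agrees with \<open>f\<close> below \<open>n\<close>; the hypothesis then
  replaces the cut by \<open>f\<close> itself.\<close>

lemma causal_recursion:
  fixes \<Phi> :: "(nat \<Rightarrow> nat) \<Rightarrow> nat \<Rightarrow> nat"
  assumes "\<And>h h' n. agree n h h' \<Longrightarrow> \<Phi> h n = \<Phi> h' n"
  obtains f where "\<And>n. f n = \<Phi> f n"
proof
  fix n
  let ?f = "wfrec less_than \<Phi>"
  have "?f n = \<Phi> (cut ?f less_than n) n"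
    by (rule wfrec) simp
  also have "\<dots> = \<Phi> ?f n"
    by (rule assms) (simp add: agree_def cut_def)
  finally show "?f n = \<Phi> ?f n" .
qed

lemma extend_lists:
  assumes "P \<sigma>" and step: "\<And>\<tau>. P \<tau> \<Longrightarrow> \<exists>b. P (\<tau> @ [b])"
  obtains y where "map y [0..<length \<sigma>] = \<sigma>" "\<And>n. length \<sigma> \<le> n \<Longrightarrow> P (map y [0..<n])"
proof -
  obtain c where c: "\<And>\<tau>. P \<tau> \<Longrightarrow> P (\<tau> @ [c \<tau>])"
    using step by metis
  define L where "L = rec_nat \<sigma> (\<lambda>_ \<tau>. \<tau> @ [c \<tau>])"
  have L: "L 0 = \<sigma>" "L (Suc n) = L n @ [c (L n)]" for n
    by (simp_all add: L_def)
  have len: "length (L n) = length \<sigma> + n" for n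
    by (induction n) (auto simp: L)
  have P: "P (L n)" for n
    by (induction n) (auto simp: L assms c)
  \<comment> \<open>\<open>L (Suc i)\<close> has length \<open>length \<sigma> + Suc i\<close>, so
    position \<open>i\<close> exists in it even for empty \<open>\<sigma>\<close>.\<close>
  define y where "y i = L (Suc i) ! i" for i
  have nth: "L (m + d) ! i = L m ! i" if "i < length \<sigma> + m" for m d i
    using that by (induction d) (auto simp: L nth_append len)
  have y: "L n ! i = y i" if i: "i < length \<sigma> + n" for n i
  proof (cases "n \<le> Suc i")
    case True
    then show ?thesis
      using nth[OF i, of "Suc i - n"] by (simp add: y_def)
  next
    case False
    then show ?thesis
      using nth[of i "Suc i" "n - Suc i"] by (simp add: y_def)
  qed
  have *: "map y [0..<length \<sigma> + n] = L n" for n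
    by (rule nth_equalityI) (auto simp: len y)
  show ?thesis
  proof
    show "map y [0..<length \<sigma>] = \<sigma>"
      using *[of 0] by (simp add: L)
    show "P (map y [0..<n])" if "length \<sigma> \<le> n" for n
      using *[of "n - length \<sigma>"] P[of "n - length \<sigma>"] that by simp
  qed
qed

text \<open>A typical use reduced to its continuous content: \<open>F f\<close> is the 2-colouring
  that is passed on, and of the solution computed from an answer \<open>y\<close> for
  \<open>F f\<close> only the colour \<open>S f y\<close> is kept.\<close>

locale reduction =
  fixes F :: "(nat \<Rightarrow> nat) \<Rightarrow> nat \<Rightarrow> nat"
    and S :: "(nat \<Rightarrow> nat) \<Rightarrow> (nat \<Rightarrow> nat) \<Rightarrow> nat"
  assumes cont_F: "\<And>f n. \<exists>k. \<forall>f'. agree k f f' \<longrightarrow> F f' n = F f n"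
    and cont_S: "\<And>f y. \<exists>k. \<forall>f' y'. agree k f f' \<longrightarrow> agree k y y' \<longrightarrow> S f' y' = S f y"
begin

text \<open>\<open>trunc 2\<close> sends every value except 1 to 0, so this one test decides the
  truncated colour.\<close>

definition entry :: "(nat \<Rightarrow> nat) \<Rightarrow> nat \<Rightarrow> nat \<Rightarrow> bool" where
  "entry f a b \<longleftrightarrow> F f (prod_encode (a, b)) = 1"

text \<open>The approximations below consult \<open>f\<close> only through such statements, hence
  never at or beyond \<open>y\<close>; this lets \<open>f\<close> be defined by recursion against
  them.\<close>

definition forced :: "(nat \<Rightarrow> nat) \<Rightarrow> nat \<Rightarrow> ((nat \<Rightarrow> nat) \<Rightarrow> bool) \<Rightarrow> bool" where
  "forced f y \<Phi> \<longleftrightarrow> (\<forall>f'. agree y f f' \<longrightarrow> \<Phi> f')"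

lemma forced_cong:
  assumes "agree y f f'"
  shows "forced f y = forced f' y"
proof
  show "forced f y \<Phi> = forced f' y \<Phi>" for \<Phi>
    using assms by (auto simp: forced_def agree_def)
qed

lemma forced_true: "forced f y \<Phi> \<Longrightarrow> \<Phi> f"
  by (auto simp: forced_def agree_def)

lemma forced_mono: "forced f y \<Phi> \<Longrightarrow> y \<le> y' \<Longrightarrow> forced f y' \<Phi>"
  unfolding forced_def using agree_mono by blast

lemma forced_eventually: "forced f y \<Phi> \<Longrightarrow> \<forall>\<^sub>F y in sequentially. forced f y \<Phi>"
  unfolding eventually_sequentially using forced_mono by blast

lemma forced_entry:
  assumes "entry f a b = v"
  shows "\<forall>\<^sub>F y in sequentially. forced f y (\<lambda>f'. entry f' a b = v)"
proof -
  obtain k where "\<forall>f'. agree k f f' \<longrightarrow> F f' (prod_encode (a, b)) = F f (prod_encode (a, b))"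
    using cont_F by blast
  then have "forced f k (\<lambda>f'. entry f' a b = v)"
    using assms by (auto simp: forced_def entry_def)
  then show ?thesis
    by (rule forced_eventually)
qed

section \<open>The limit row of the 2-colouring and its approximations\<close>

text \<open>
  The lexicographic limes inferior, with \<open>True\<close> below \<open>False\<close>, of the rows \<open>\<lambda>a. entry f a b\<close> as
  \<open>b \<rightarrow> \<infinity>\<close>, and its approximation that sees \<open>f\<close> below \<open>y\<close> and ignores the \<open>b \<le> x\<close>.
\<close>

function limrow :: "(nat \<Rightarrow> nat) \<Rightarrow> nat \<Rightarrow> bool" where
  "limrow f a \<longleftrightarrow> (\<exists>\<^sub>\<infinity>b. (\<forall>a'\<in>{..<a}. entry f a' b = limrow f a') \<and> entry f a b)"
  by auto
termination by (relation "measure snd") auto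

function limrow_appr :: "(nat \<Rightarrow> nat) \<Rightarrow> nat \<Rightarrow> nat \<Rightarrow> nat \<Rightarrow> bool" where
  "limrow_appr f x y a \<longleftrightarrow>
     (\<exists>b>x. (\<forall>a'\<in>{..<a}. forced f y (\<lambda>f'. entry f' a' b = limrow_appr f x y a')) \<and>
            forced f y (\<lambda>f'. entry f' a b))"
  by auto
termination by (relation "measure (snd \<circ> snd \<circ> snd)") auto

declare limrow.simps [simp del] limrow_appr.simps [simp del]

lemma limrow_appr_cong: "agree y f f' \<Longrightarrow> limrow_appr f x y a = limrow_appr f' x y a"
proof (induction a rule: less_induct)
  case (less a)
  then show ?case
    by (subst (1 2) limrow_appr.simps) (simp add: forced_cong[OF less.prems])
qed

text \<open>Eventual truth along a double limit, first in \<open>y\<close>, then in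
  \<open>x\<close>: the bound for \<open>y\<close> may depend on \<open>x\<close>.\<close>

abbreviation ev2 :: "(nat \<Rightarrow> nat \<Rightarrow> bool) \<Rightarrow> bool" where
  "ev2 P \<equiv> (\<forall>\<^sub>F x in sequentially. \<forall>\<^sub>F y in sequentially. P x y)"

lemma ev2_mono: "ev2 P \<Longrightarrow> (\<And>x y. P x y \<Longrightarrow> Q x y) \<Longrightarrow> ev2 Q"
  by (auto elim!: eventually_mono)

lemma ev2_conj: "ev2 P \<Longrightarrow> ev2 Q \<Longrightarrow> ev2 (\<lambda>x y. P x y \<and> Q x y)"
  by (simp add: eventually_conj_iff)

lemma ev2_ball: "finite A \<Longrightarrow> (\<And>a. a \<in> A \<Longrightarrow> ev2 (P a)) \<Longrightarrow> ev2 (\<lambda>x y. \<forall>a\<in>A. P a x y)"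
  by (simp add: eventually_ball_finite_distrib)

text \<open>Induction on \<open>a\<close>, once the earlier entries have settled. If the limit is
  \<open>True\<close>, a suitable \<open>b > x\<close> always exists, and all large \<open>y\<close>
  see enough of \<open>f\<close> to confirm it. If it is \<open>False\<close>, the suitable
  \<open>b\<close> are bounded, and a larger \<open>x\<close> excludes them, since what is forced is
  true.\<close>

lemma limrow_appr_converges: "ev2 (\<lambda>x y. limrow_appr f x y a = limrow f a)"
proof (induction a rule: less_induct)
  case (less a)
  then have IH: "ev2 (\<lambda>x y. \<forall>a'\<in>{..<a}. limrow_appr f x y a' = limrow f a')"
    by (intro ev2_ball) auto
  let ?R = "\<lambda>b. (\<forall>a'\<in>{..<a}. entry f a' b = limrow f a') \<and> entry f a b"
  show ?case
  proof (cases "limrow f a")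
    case True
    then have inf: "\<exists>\<^sub>\<infinity>b. ?R b"
      by (simp add: limrow.simps[of f a])
    from IH show ?thesis
    proof (rule eventually_mono)
      fix x assume x: "\<forall>\<^sub>F y in sequentially. \<forall>a'\<in>{..<a}. limrow_appr f x y a' = limrow f a'"
      obtain b where b: "b > x" "?R b"
        using inf by (auto simp: INFM_nat)
      have "\<forall>\<^sub>F y in sequentially. \<forall>a'\<in>{..<a}. forced f y (\<lambda>f'. entry f' a' b = limrow f a')"
        using b(2) by (intro eventually_ball_finite) (auto intro: forced_entry)
      moreover have "\<forall>\<^sub>F y in sequentially. forced f y (\<lambda>f'. entry f' a b = True)"
        using b(2) by (intro forced_entry) auto
      ultimately show "\<forall>\<^sub>F y in sequentially. limrow_appr f x y a = limrow f a"
        using x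
      proof eventually_elim
        case (elim y)
        then show ?case
          using b(1) True by (subst limrow_appr.simps) auto
      qed
    qed
  next
    case False
    then obtain x0 where x0: "\<And>b. b > x0 \<Longrightarrow> \<not> ?R b"
      by (auto simp: limrow.simps[of f a] INFM_nat)
    have "ev2 (\<lambda>x y. x \<ge> x0)"
      by (rule eventually_mono[OF eventually_ge_at_top[of x0]]) auto
    from ev2_conj[OF this IH] show ?thesis
    proof (rule ev2_mono)
      fix x y assume xy: "x0 \<le> x \<and> (\<forall>a'\<in>{..<a}. limrow_appr f x y a' = limrow f a')"
      have "\<not> limrow_appr f x y a"
      proof
        assume "limrow_appr f x y a"
        then obtain b where "b > x"
          "\<forall>a'\<in>{..<a}. forced f y (\<lambda>f'. entry f' a' b = limrow_appr f x y a')"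
          "forced f y (\<lambda>f'. entry f' a b)"
          by (subst (asm) limrow_appr.simps) auto
        then show False
          using x0[of b] xy by (auto dest!: forced_true)
      qed
      then show "limrow_appr f x y a = limrow f a"
        using False by simp
    qed
  qed
qed

text \<open>Inductively, infinitely many \<open>b\<close> match the limit below \<open>n\<close>. If
  the limit at \<open>n\<close> is \<open>False\<close>, only finitely many of them have
  \<open>True\<close> there, so infinitely many have \<open>False\<close>.\<close>

lemma limrow_attained: "\<exists>\<^sub>\<infinity>b. \<forall>a<n. entry f a b = limrow f a"
proof (induction n)
  case (Suc n)
  let ?P = "\<lambda>b. \<forall>a<n. entry f a b = limrow f a"
  have "\<exists>\<^sub>\<infinity>b. ?P b \<and> entry f n b = limrow f n"
  proof (cases "limrow f n")
    case True
    then show ?thesis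
      by (simp add: limrow.simps[of f n] Ball_def)
  next
    case False
    then have "\<not> (\<exists>\<^sub>\<infinity>b. ?P b \<and> entry f n b)"
      by (simp add: limrow.simps[of f n] Ball_def)
    moreover have "\<exists>\<^sub>\<infinity>b. (?P b \<and> entry f n b) \<or> (?P b \<and> \<not> entry f n b)"
      using Suc.IH by (rule INFM_mono) auto
    ultimately have "\<exists>\<^sub>\<infinity>b. ?P b \<and> \<not> entry f n b"
      using INFM_disj_distrib by blast
    then show ?thesis
      using False by simp
  qed
  then show ?case
    by (rule INFM_mono) (auto simp: less_Suc_eq)
qed simp

text \<open>If both colours failed, at thresholds \<open>k\<close> and \<open>l\<close>, the
  infinitely many \<open>b\<close> that match the limit below \<open>max k l\<close> would split
  into two finite sets.\<close>

lemma colour_exists: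
  obtains i where "\<And>n. \<exists>\<^sub>\<infinity>b. limrow f b = i \<and> (\<forall>a<n. entry f a b = limrow f a)"
proof (rule ccontr)
  assume "\<not> thesis"
  then have "\<exists>n. \<not> (\<exists>\<^sub>\<infinity>b. limrow f b = i \<and> (\<forall>a<n. entry f a b = limrow f a))" for i
    using that by blast
  from this[of True] this[of False] obtain k l
    where k: "\<not> (\<exists>\<^sub>\<infinity>b. limrow f b = True \<and> (\<forall>a<k. entry f a b = limrow f a))"
      and l: "\<not> (\<exists>\<^sub>\<infinity>b. limrow f b = False \<and> (\<forall>a<l. entry f a b = limrow f a))"
    by blast
  have "\<exists>\<^sub>\<infinity>b. (limrow f b = True \<and> (\<forall>a<k. entry f a b = limrow f a)) \<or>
    (limrow f b = False \<and> (\<forall>a<l. entry f a b = limrow f a))"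
    using limrow_attained[of "max k l" f] by (rule INFM_mono) auto
  then show False
    unfolding INFM_disj_distrib using k l by blast
qed

section \<open>Finite homogeneous lists and their infinite extensions\<close>

text \<open>As for solutions of Ramsey's theorem, the head of the list is the colour.\<close>

definition row_homogeneous :: "bool \<Rightarrow> (nat \<Rightarrow> nat) \<Rightarrow> nat list \<Rightarrow> bool" where
  "row_homogeneous i f \<sigma> \<longleftrightarrow> \<sigma> \<noteq> [] \<and> \<sigma> ! 0 = of_bool i \<and> sorted_wrt (<) \<sigma> \<and>
     (\<forall>a\<in>set (tl \<sigma>). limrow f a = i) \<and> sorted_wrt (\<lambda>a b. entry f a b = i) (tl \<sigma>)"

text \<open>The new point lies above all of \<open>\<sigma>\<close> and its row matches the limit
  there, so its entry with each earlier point \<open>a\<close> is \<open>limrow f a = i\<close>. Its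
  own limit value is \<open>i\<close> too, which prepares the next extension.\<close>

lemma row_homogeneous_extend:
  assumes i: "\<And>n. \<exists>\<^sub>\<infinity>b. limrow f b = i \<and> (\<forall>a<n. entry f a b = limrow f a)"
    and \<sigma>: "row_homogeneous i f \<sigma>"
  shows "\<exists>b. row_homogeneous i f (\<sigma> @ [b])"
proof -
  define n where "n = Suc (Max (set \<sigma>))"
  have n: "a < n" if "a \<in> set \<sigma>" for a
    using that by (simp add: n_def less_Suc_eq_le)
  obtain b where b: "b > n" "limrow f b = i" "\<forall>a<n. entry f a b = limrow f a"
    using i[of n] by (auto simp: INFM_nat)
  have "a \<in> set \<sigma>" if "a \<in> set (tl \<sigma>)" for a
    using that by (cases \<sigma>) auto
  then have "row_homogeneous i f (\<sigma> @ [b])"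
    using \<sigma> b n by (fastforce simp: row_homogeneous_def sorted_wrt_append nth_append)
  then show ?thesis ..
qed

lemma row_homogeneous_solution:
  assumes "\<And>n. l \<le> n \<Longrightarrow> row_homogeneous i f (map y [0..<n])"
  shows "homogeneous 2 (F f) y"
  unfolding homogeneous_def
proof (intro allI conjI impI)
  fix m
  \<comment> \<open>Long enough for the hypothesis and for the positions \<open>m\<close> and
    \<open>Suc m\<close>. The index shift by 1 further down comes from \<open>tl\<close>, which
    drops the colour.\<close>
  let ?n = "l + m + 2"
  let ?\<sigma> = "map y [0..<?n]"
  have r: "row_homogeneous i f ?\<sigma>"
    by (rule assms) simp
  then have s: "sorted_wrt (<) ?\<sigma>" and h: "sorted_wrt (\<lambda>a b. entry f a b = i) (tl ?\<sigma>)"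
    and y0: "?\<sigma> ! 0 = of_bool i"
    unfolding row_homogeneous_def by blast+
  show "y m < y (Suc m)"
    using sorted_wrt_nth_less[OF s, of m "Suc m"] by (simp del: upt_Suc)
  fix j k assume jk: "0 < j \<and> j < k \<and> k < m"
  have "entry f (tl ?\<sigma> ! (j - 1)) (tl ?\<sigma> ! (k - 1)) = i"
    using jk by (intro sorted_wrt_nth_less[OF h]) (auto simp del: upt_Suc)
  moreover have "tl ?\<sigma> ! (n - 1) = y n" if "0 < n" "n < m" for n
    using that nth_tl[of "n - 1" ?\<sigma>] by (simp del: upt_Suc)
  ultimately have "entry f (y j) (y k) = i"
    using jk by simp
  moreover have "y 0 = of_bool i"
    using y0 by (simp del: upt_Suc)
  ultimately show "trunc 2 (F f (prod_encode (y j, y k))) = y 0"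
    by (auto simp: trunc_def entry_def)
qed

text \<open>Extensions of \<open>\<sigma>\<close> that are no solutions count too, so the condition
  involves no homogeneity and can be forced by a finite part of \<open>f\<close>.\<close>

definition colour_by :: "nat list \<Rightarrow> nat \<Rightarrow> (nat \<Rightarrow> nat) \<Rightarrow> bool" where
  "colour_by \<sigma> c f \<longleftrightarrow> (\<forall>y. map y [0..<length \<sigma>] = \<sigma> \<longrightarrow> S f y = c)"

definition good :: "bool \<Rightarrow> (nat \<Rightarrow> nat) \<Rightarrow> nat list \<Rightarrow> nat \<Rightarrow> bool" where
  "good i f \<sigma> c \<longleftrightarrow> row_homogeneous i f \<sigma> \<and> (\<exists>y. forced f y (colour_by \<sigma> c))"

text \<open>This is \<open>good\<close> with \<open>limrow\<close> replaced by its approximation and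
  all other facts about \<open>f\<close> forced, so that it depends on \<open>f\<close> below
  \<open>y\<close> only.\<close>

definition good_appr :: "bool \<Rightarrow> (nat \<Rightarrow> nat) \<Rightarrow> nat \<Rightarrow> nat \<Rightarrow> nat list \<Rightarrow> nat \<Rightarrow> bool" where
  "good_appr i f x y \<sigma> c \<longleftrightarrow> \<sigma> \<noteq> [] \<and> \<sigma> ! 0 = of_bool i \<and> sorted_wrt (<) \<sigma> \<and>
     (\<forall>a\<in>set (tl \<sigma>). limrow_appr f x y a = i) \<and>
     forced f y (\<lambda>f'. sorted_wrt (\<lambda>a b. entry f' a b = i) (tl \<sigma>)) \<and>
     forced f y (colour_by \<sigma> c)"

lemma forced_sorted:
  assumes "sorted_wrt (\<lambda>a b. entry f a b = i) \<sigma>"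
  shows "\<forall>\<^sub>F y in sequentially. forced f y (\<lambda>f'. sorted_wrt (\<lambda>a b. entry f' a b = i) \<sigma>)"
  using assms
proof (induction \<sigma>)
  case Nil
  then show ?case by (simp add: forced_def)
next
  case (Cons a \<sigma>)
  have "\<forall>\<^sub>F y in sequentially. \<forall>b\<in>set \<sigma>. forced f y (\<lambda>f'. entry f' a b = i)"
    using Cons.prems by (intro eventually_ball_finite ballI forced_entry) auto
  moreover have "\<forall>\<^sub>F y in sequentially. forced f y (\<lambda>f'. sorted_wrt (\<lambda>a b. entry f' a b = i) \<sigma>)"
    using Cons by simp
  ultimately show ?case
    by eventually_elim (auto simp: forced_def)
qed

text \<open>The condition is never vacuous: \<open>\<sigma>\<close> itself, read as a function by
  \<open>!\<close>, is one of its extensions.\<close>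

lemma colour_by_unique:
  assumes "colour_by \<sigma> c f" "colour_by \<sigma> c' f"
  shows "c = c'"
proof -
  have "map (\<lambda>i. \<sigma> ! i) [0..<length \<sigma>] = \<sigma>"
    by (simp add: map_nth)
  then show ?thesis
    using assms unfolding colour_by_def by blast
qed

text \<open>For fixed \<open>\<sigma>\<close> each conjunct settles. Uniformity in \<open>c\<close>
  is possible because at most one colour can be forced for \<open>\<sigma>\<close>.\<close>

lemma good_appr_converges: "ev2 (\<lambda>x y. \<forall>c. good_appr i f x y \<sigma> c = good i f \<sigma> c)"
proof -
  have lim: "ev2 (\<lambda>x y. \<forall>a\<in>set (tl \<sigma>). limrow_appr f x y a = limrow f a)"
    by (rule ev2_ball) (auto intro: limrow_appr_converges)
  have "\<forall>\<^sub>F y in sequentially. (forced f y (\<lambda>f'. sorted_wrt (\<lambda>a b. entry f' a b = i) (tl \<sigma>)) \<longleftrightarrow>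
       sorted_wrt (\<lambda>a b. entry f a b = i) (tl \<sigma>))"
  proof (cases "sorted_wrt (\<lambda>a b. entry f a b = i) (tl \<sigma>)")
    case True
    show ?thesis
      using forced_sorted[OF True] by eventually_elim (use True in simp)
  next
    case False
    then have "\<not> forced f y (\<lambda>f'. sorted_wrt (\<lambda>a b. entry f' a b = i) (tl \<sigma>))" for y
      using forced_true by blast
    then show ?thesis
      using False by simp
  qed
  then have srt: "ev2 (\<lambda>x y. forced f y (\<lambda>f'. sorted_wrt (\<lambda>a b. entry f' a b = i) (tl \<sigma>)) \<longleftrightarrow>
       sorted_wrt (\<lambda>a b. entry f a b = i) (tl \<sigma>))"
    by simp
  have "\<forall>\<^sub>F y in sequentially. \<forall>c. forced f y (colour_by \<sigma> c) = (\<exists>y. forced f y (colour_by \<sigma> c))"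
  proof (cases "\<exists>c y. forced f y (colour_by \<sigma> c)")
    case True
    then obtain c y where cy: "forced f y (colour_by \<sigma> c)"
      by blast
    have "c' = c" if "forced f y' (colour_by \<sigma> c')" for c' y'
      using colour_by_unique forced_true[OF that] forced_true[OF cy] by blast
    with forced_eventually[OF cy] show ?thesis
      by (auto elim!: eventually_mono)
  qed auto
  then have col: "ev2 (\<lambda>x y. \<forall>c. forced f y (colour_by \<sigma> c) = (\<exists>y. forced f y (colour_by \<sigma> c)))"
    by simp
  show ?thesis
    by (rule ev2_mono[OF ev2_conj[OF lim ev2_conj[OF srt col]]])
      (auto simp: good_appr_def good_def row_homogeneous_def)
qed

text \<open>Since lists are searched by their codes, the guess settles as soon as the finitely many
  codes up to the first good one have settled. Where no list qualifies, the value is arbitrary, but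
  still determined by \<open>f\<close> below \<open>y\<close>.\<close>

definition guess :: "bool \<Rightarrow> (nat \<Rightarrow> nat) \<Rightarrow> nat \<Rightarrow> nat \<Rightarrow> nat" where
  "guess i f x y =
     (SOME c. good_appr i f x y (list_decode (LEAST n. \<exists>c. good_appr i f x y (list_decode n) c)) c)"

lemma guess_cong:
  assumes "agree y f f'"
  shows "guess i f x y = guess i f' x y"
proof -
  have "good_appr i f x y = good_appr i f' x y"
    by (intro ext) (simp add: good_appr_def limrow_appr_cong[OF assms] forced_cong[OF assms])
  then show ?thesis
    by (simp add: guess_def)
qed

text \<open>Continuity of \<open>S\<close> at one solution yields a good list. The solution in the
  conclusion is then chosen to extend the first good list, so \<open>S\<close> maps it to the colour
  to which the guesses converge.\<close>

lemma guess_converges: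
  obtains i y where "homogeneous 2 (F f) y" "ev2 (\<lambda>x z. guess i f x z = S f y)"
proof -
  obtain i where i: "\<And>n. \<exists>\<^sub>\<infinity>b. limrow f b = i \<and> (\<forall>a<n. entry f a b = limrow f a)"
    using colour_exists by blast
  have ext: "\<exists>y. map y [0..<length \<sigma>] = \<sigma> \<and> homogeneous 2 (F f) y \<and>
     (\<forall>n. length \<sigma> \<le> n \<longrightarrow> row_homogeneous i f (map y [0..<n]))" if "row_homogeneous i f \<sigma>" for \<sigma>
    by (rule extend_lists[of "row_homogeneous i f", OF that row_homogeneous_extend[OF i]])
      (auto intro: row_homogeneous_solution)
  have "row_homogeneous i f [of_bool i]"
    by (simp add: row_homogeneous_def)
  from ext[OF this] obtain y where y: "\<And>n. 1 \<le> n \<Longrightarrow> row_homogeneous i f (map y [0..<n])"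
    by auto
  obtain k where k: "\<And>f' y'. agree k f f' \<Longrightarrow> agree k y y' \<Longrightarrow> S f' y' = S f y"
    using cont_S by blast
  \<comment> \<open>Length \<open>Suc k\<close> instead of \<open>k\<close> keeps the list nonempty:
    its head is the colour.\<close>
  let ?\<tau> = "map y [0..<Suc k]"
  have "forced f k (colour_by ?\<tau> (S f y))"
    unfolding forced_def colour_by_def
    by (intro allI impI k) (auto simp: agree_def)
  then have "good i f ?\<tau> (S f y)"
    using y[of "Suc k"] by (auto simp: good_def simp del: upt_Suc)
  then have ex: "\<exists>n c. good i f (list_decode n) c"
    by (metis list_encode_inverse)
  define n where "n = (LEAST n. \<exists>c. good i f (list_decode n) c)"
  define \<sigma> where "\<sigma> = list_decode n"
  obtain c where c: "good i f \<sigma> c"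
    using LeastI_ex[OF ex] by (auto simp: n_def \<sigma>_def)
  obtain z where z: "map z [0..<length \<sigma>] = \<sigma>" "homogeneous 2 (F f) z"
    using ext[of \<sigma>] c by (auto simp: good_def)
  have Sz: "S f z = c"
    using c z(1) by (auto simp: good_def colour_by_def dest!: forced_true)
  have uniq: "c' = c" if "good i f \<sigma> c'" for c'
    using c that colour_by_unique unfolding good_def by (metis forced_true)
  have "ev2 (\<lambda>x y. \<forall>m\<in>{..n}. \<forall>c. good_appr i f x y (list_decode m) c = good i f (list_decode m) c)"
    by (rule ev2_ball) (auto intro: good_appr_converges)
  then have "ev2 (\<lambda>x y. guess i f x y = S f z)"
  proof (rule ev2_mono)
    fix x y
    assume eq: "\<forall>m\<in>{..n}. \<forall>c. good_appr i f x y (list_decode m) c = good i f (list_decode m) c"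
    have "(LEAST n. \<exists>c. good_appr i f x y (list_decode n) c) = n"
    proof (rule Least_equality)
      show "\<exists>c. good_appr i f x y (list_decode n) c"
        using eq c by (auto simp: \<sigma>_def)
      fix m assume m: "\<exists>c. good_appr i f x y (list_decode m) c"
      show "n \<le> m"
      proof (rule ccontr)
        assume "\<not> n \<le> m"
        with eq m have "\<exists>c. good i f (list_decode m) c" by auto
        then have "n \<le> m" unfolding n_def by (rule Least_le)
        then show False using \<open>\<not> n \<le> m\<close> by simp
      qed
    qed
    then have "guess i f x y = (SOME c. good_appr i f x y \<sigma> c)"
      by (simp add: guess_def \<sigma>_def)
    also have "\<dots> = (SOME c. good i f \<sigma> c)"
      using eq by (simp add: \<sigma>_def)
    also have "\<dots> = c"
      using c uniq by (rule some_equality)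
    finally show "guess i f x y = S f z"
      by (simp add: Sz)
  qed
  then show ?thesis
    using that z(2) by blast
qed

text \<open>Which of the two guesses converges depends on \<open>f\<close>, so \<open>f\<close>
  avoids both. Three values suffice for that, and being below 4 they are unchanged by truncation. A
  homogeneous set of the limit colour would contain a pair at which the guess has settled.\<close>

theorem no_colour_reduction:
  "\<exists>f y. homogeneous 2 (F f) y \<and> \<not> (\<exists>z. homogeneous 4 f z \<and> z 0 = S f y)"
proof -
  have avoid: "\<exists>c<3. c \<noteq> a \<and> c \<noteq> b" for a b :: nat
  proof -
    have "0 \<noteq> a \<and> 0 \<noteq> b \<or> 1 \<noteq> a \<and> 1 \<noteq> b \<or> 2 \<noteq> a \<and> 2 \<noteq> b"
      by linarith
    then show ?thesis
      by (metis numeral_less_iff one_less_numeral_iff semiring_norm(77,81) zero_less_numeral lessI numeral_3_eq_3 numeral_2_eq_2)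
  qed
  then obtain pick :: "nat \<Rightarrow> nat \<Rightarrow> nat"
    where pick: "\<And>a b. pick a b < 3 \<and> pick a b \<noteq> a \<and> pick a b \<noteq> b"
    by metis
  \<comment> \<open>The guesses at \<open>(x, y)\<close> see \<open>h\<close> only below
    \<open>y\<close>, and \<open>y\<close> is at most the code of \<open>(x, y)\<close>, so the
    recursion is causal.\<close>
  define \<Phi> where "\<Phi> h n = (case prod_decode n of (x, y) \<Rightarrow> pick (guess False h x y) (guess True h x y))"
    for h n
  have "\<Phi> h n = \<Phi> h' n" if "agree n h h'" for h h' n
  proof -
    obtain x y where xy: "prod_decode n = (x, y)" by fastforce
    then have "y \<le> n"
      by (metis le_prod_encode_2 prod_decode_inverse)
    then have "agree y h h'"
      using that agree_mono by blast
    then show ?thesis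
      using guess_cong by (simp add: \<Phi>_def xy)
  qed
  then obtain f where f: "\<And>n. f n = \<Phi> f n"
    using causal_recursion by metis
  have f_pair: "f (prod_encode (x, y)) = pick (guess False f x y) (guess True f x y)" for x y
    by (subst f) (simp add: \<Phi>_def)
  obtain i y where y: "homogeneous 2 (F f) y" and conv: "ev2 (\<lambda>x z. guess i f x z = S f y)"
    using guess_converges by blast
  have ne: "f (prod_encode (x, z)) \<noteq> guess i f x z" for x z
    using pick by (cases i) (auto simp: f_pair)
  have "\<not> (homogeneous 4 f z \<and> z 0 = S f y)" for z
  proof
    assume z: "homogeneous 4 f z \<and> z 0 = S f y"
    then have "strict_mono z"
      by (auto simp: homogeneous_def strict_mono_Suc_iff)
    then have le: "n \<le> z n" for n
      by (rule strict_mono_imp_increasing)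
    have hom: "f (prod_encode (z j, z k)) = S f y" if "0 < j" "j < k" for j k
    proof -
      have "trunc 4 (f (prod_encode (z j, z k))) = S f y"
        using z that unfolding homogeneous_def by (metis lessI)
      moreover have "f (prod_encode (z j, z k)) < 3"
        using pick by (simp add: f_pair)
      ultimately show ?thesis by (simp add: trunc_def)
    qed
    obtain x0 where "\<And>x. x0 \<le> x \<Longrightarrow> \<forall>\<^sub>F w in sequentially. guess i f x w = S f y"
      using conv by (auto simp: eventually_sequentially)
    then have "\<forall>\<^sub>F w in sequentially. guess i f (z (Suc x0)) w = S f y"
      using le[of "Suc x0"] by simp
    then obtain w0 where w0: "\<And>w. w0 \<le> w \<Longrightarrow> guess i f (z (Suc x0)) w = S f y"
      by (auto simp: eventually_sequentially)
    \<comment> \<open>Index \<open>Suc x0\<close> is positive, as \<open>z 0\<close> is the colour,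
      and \<open>z (Suc x0)\<close> exceeds \<open>x0\<close>. The index \<open>k\<close> is larger
      still and, by \<open>n \<le> z n\<close>, brings \<open>z k\<close> beyond
      \<open>w0\<close>.\<close>
    define k where "k = Suc (Suc x0) + w0"
    have "guess i f (z (Suc x0)) (z k) = S f y"
      using w0 le[of k] by (simp add: k_def)
    moreover have "f (prod_encode (z (Suc x0), z k)) = S f y"
      by (rule hom) (auto simp: k_def)
    ultimately show False
      using ne by metis
  qed
  with y show ?thesis by blast
qed

end

section \<open>The graph model\<close>

text \<open>
  In the graph model an element \<open>prod_encode (set_encode e, n)\<close> of \<open>A\<close> says that \<open>n\<close> belongs to the
  value of \<open>A\<close> at every argument that includes the finite set \<open>e\<close>.
\<close>

definition app :: "nat set \<Rightarrow> nat set \<Rightarrow> nat set" where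
  "app A B = {n. \<exists>e. finite e \<and> e \<subseteq> B \<and> prod_encode (set_encode e, n) \<in> A}"

definition graph :: "(nat set \<Rightarrow> nat set) \<Rightarrow> nat set" where
  "graph \<phi> = {prod_encode (set_encode e, n) | e n. finite e \<and> n \<in> \<phi> e}"

definition scott :: "(nat set \<Rightarrow> nat set) \<Rightarrow> bool" where
  "scott \<phi> \<longleftrightarrow> (\<forall>X n. n \<in> \<phi> X \<longleftrightarrow> (\<exists>e. finite e \<and> e \<subseteq> X \<and> n \<in> \<phi> e))"

lemma scottI:
  assumes "\<And>X Y. X \<subseteq> Y \<Longrightarrow> \<phi> X \<subseteq> \<phi> Y"
    and "\<And>X n. n \<in> \<phi> X \<Longrightarrow> \<exists>e. finite e \<and> e \<subseteq> X \<and> n \<in> \<phi> e"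
  shows "scott \<phi>"
  unfolding scott_def by (meson assms subsetD)

lemma scott_mono: "scott \<phi> \<Longrightarrow> X \<subseteq> Y \<Longrightarrow> \<phi> X \<subseteq> \<phi> Y"
  unfolding scott_def subset_iff by meson

lemma scott_finite: "scott \<phi> \<Longrightarrow> n \<in> \<phi> X \<Longrightarrow> \<exists>e. finite e \<and> e \<subseteq> X \<and> n \<in> \<phi> e"
  unfolding scott_def by blast

lemma scott_finite_set:
  assumes "scott \<phi>" "finite d" "d \<subseteq> \<phi> X"
  shows "\<exists>e. finite e \<and> e \<subseteq> X \<and> d \<subseteq> \<phi> e"
  using assms(2,3)
proof (induction d)
  case (insert n d)
  then obtain e e' where "finite e" "e \<subseteq> X" "d \<subseteq> \<phi> e" "finite e'" "e' \<subseteq> X" "n \<in> \<phi> e'"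
    using scott_finite[OF assms(1)] by (metis insert_subset)
  moreover have "\<phi> e \<subseteq> \<phi> (e \<union> e')" "\<phi> e' \<subseteq> \<phi> (e \<union> e')"
    using scott_mono[OF assms(1)] by simp_all
  ultimately show ?case
    by (intro exI[of _ "e \<union> e'"]) auto
qed auto

lemma scott_const: "scott (\<lambda>X. A)"
  by (auto simp: scott_def)

lemma scott_id: "scott (\<lambda>X. X)"
  by (rule scottI) (auto intro: exI[of _ "{n}" for n])

lemma app_mono: "A \<subseteq> A' \<Longrightarrow> B \<subseteq> B' \<Longrightarrow> app A B \<subseteq> app A' B'"
  unfolding app_def by blast

lemma scott_app:
  assumes "scott \<phi>" "scott \<psi>"
  shows "scott (\<lambda>X. app (\<phi> X) (\<psi> X))"
proof (rule scottI)
  show "X \<subseteq> Y \<Longrightarrow> app (\<phi> X) (\<psi> X) \<subseteq> app (\<phi> Y) (\<psi> Y)" for X Y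
    by (rule app_mono) (simp_all add: scott_mono[OF assms(1)] scott_mono[OF assms(2)])
  fix X n assume "n \<in> app (\<phi> X) (\<psi> X)"
  then obtain d where d: "finite d" "d \<subseteq> \<psi> X" "prod_encode (set_encode d, n) \<in> \<phi> X"
    by (auto simp: app_def)
  obtain e e' where e: "finite e" "e \<subseteq> X" "d \<subseteq> \<psi> e"
    and e': "finite e'" "e' \<subseteq> X" "prod_encode (set_encode d, n) \<in> \<phi> e'"
    using scott_finite_set[OF assms(2) d(1,2)] scott_finite[OF assms(1) d(3)] by blast
  have "\<psi> e \<subseteq> \<psi> (e \<union> e')" "\<phi> e' \<subseteq> \<phi> (e \<union> e')"
    by (simp_all add: scott_mono[OF assms(1)] scott_mono[OF assms(2)])
  then have "n \<in> app (\<phi> (e \<union> e')) (\<psi> (e \<union> e'))"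
    unfolding app_def using d(1) e(3) e'(3) by blast
  then show "\<exists>e. finite e \<and> e \<subseteq> X \<and> n \<in> app (\<phi> e) (\<psi> e)"
    using e e' by (intro exI[of _ "e \<union> e'"]) auto
qed

lemma mem_graph:
  "prod_encode (set_encode e, n) \<in> graph \<phi> \<longleftrightarrow> n \<in> \<phi> e" if "finite e"
  using that by (auto simp: graph_def set_encode_eq)

text \<open>One element of the graph concerns a single finite input, so continuity in
  \<open>a\<close> for each fixed \<open>b\<close> is enough.\<close>

lemma scott_graph:
  assumes "\<And>b. scott (\<lambda>a. \<phi> a b)"
  shows "scott (\<lambda>a. graph (\<phi> a))"
proof (rule scottI)
  show "X \<subseteq> Y \<Longrightarrow> graph (\<phi> X) \<subseteq> graph (\<phi> Y)" for X Y
    using scott_mono[OF assms, of X Y] unfolding graph_def by blast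
  fix X n assume "n \<in> graph (\<phi> X)"
  then obtain e m where e: "finite e" "n = prod_encode (set_encode e, m)" "m \<in> \<phi> X e"
    by (auto simp: graph_def)
  obtain d where "finite d" "d \<subseteq> X" "m \<in> \<phi> d e"
    using scott_finite[OF assms e(3)] by blast
  then show "\<exists>e. finite e \<and> e \<subseteq> X \<and> n \<in> graph (\<phi> e)"
    using mem_graph[OF e(1)] e(2) by blast
qed

text \<open>The beta law: the graph records \<open>\<phi>\<close> on finite sets only, and Scott
  continuity recovers the rest.\<close>

lemma app_graph:
  assumes "scott \<phi>"
  shows "app (graph \<phi>) X = \<phi> X"
proof (rule set_eqI)
  fix n
  have "n \<in> app (graph \<phi>) X \<longleftrightarrow> (\<exists>e. finite e \<and> e \<subseteq> X \<and> n \<in> \<phi> e)"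
    by (auto simp: app_def mem_graph)
  then show "n \<in> app (graph \<phi>) X \<longleftrightarrow> n \<in> \<phi> X"
    using assms unfolding scott_def by metis
qed

lemma scott_UN:
  assumes "\<And>n. scott (\<lambda>X. \<psi> n X)" "scott \<phi>"
  shows "scott (\<lambda>X. \<Union>n\<in>\<phi> X. \<psi> n X)"
proof (rule scottI)
  show "X \<subseteq> Y \<Longrightarrow> (\<Union>n\<in>\<phi> X. \<psi> n X) \<subseteq> (\<Union>n\<in>\<phi> Y. \<psi> n Y)" for X Y
    using scott_mono[OF assms(1), of X Y] scott_mono[OF assms(2), of X Y] by blast
  fix X m assume "m \<in> (\<Union>n\<in>\<phi> X. \<psi> n X)"
  then obtain n where n: "n \<in> \<phi> X" "m \<in> \<psi> n X" by blast
  obtain e e' where e: "finite e" "e \<subseteq> X" "n \<in> \<phi> e" and e': "finite e'" "e' \<subseteq> X" "m \<in> \<psi> n e'"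
    using scott_finite[OF assms(1) n(2)] scott_finite[OF assms(2) n(1)] by blast
  have "\<phi> e \<subseteq> \<phi> (e \<union> e')" "\<psi> n e' \<subseteq> \<psi> n (e \<union> e')"
    by (simp_all add: scott_mono[OF assms(1)] scott_mono[OF assms(2)])
  then show "\<exists>e. finite e \<and> e \<subseteq> X \<and> m \<in> (\<Union>n\<in>\<phi> e. \<psi> n e)"
    using e e' by (intro exI[of _ "e \<union> e'"]) auto
qed

fun iter :: "nat \<Rightarrow> nat set \<Rightarrow> nat set \<Rightarrow> nat set" where
  "iter 0 A B = A"
| "iter (Suc n) A B = app (app B (iter n A B)) {n}"

lemma scott_iter: "scott \<phi> \<Longrightarrow> scott \<psi> \<Longrightarrow> scott (\<lambda>X. iter n (\<phi> X) (\<psi> X))"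
  by (induction n) (auto intro: scott_app scott_const)

lemma scott_image: "scott (\<lambda>X. h ` X)"
proof -
  have "scott (\<lambda>X. \<Union>n\<in>X. {h n})"
    by (intro scott_UN scott_const scott_id)
  then show ?thesis by (simp add: UNION_singleton_eq_range)
qed

lemmas scott_intros = scott_graph scott_app scott_UN scott_iter scott_image scott_const scott_id

section \<open>Interpretations of the combinators, the successor and the recursor\<close>

definition kC :: "nat set" where
  "kC = graph (\<lambda>a. graph (\<lambda>b. a))"

definition sC :: "nat set" where
  "sC = graph (\<lambda>a. graph (\<lambda>b. graph (\<lambda>c. app (app a c) (app b c))))"

definition sucC :: "nat set" where
  "sucC = graph (\<lambda>a. Suc ` a)"

text \<open>The union makes the operation Scott continuous for arbitrary \<open>a\<close>; at a
  total argument \<open>{n}\<close> it is just \<open>iter n b c\<close>.\<close>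

definition recC :: "nat set" where
  "recC = graph (\<lambda>a. graph (\<lambda>b. graph (\<lambda>c. \<Union>n\<in>a. iter n b c)))"

lemma app_kC: "app (app kC a) b = a"
  unfolding kC_def by (subst app_graph, intro scott_intros)+ (rule refl)

lemma app_sC: "app (app (app sC a) b) c = app (app a c) (app b c)"
  unfolding sC_def by (subst app_graph, intro scott_intros)+ (rule refl)

lemma app_sucC: "app sucC a = Suc ` a"
  unfolding sucC_def by (subst app_graph, intro scott_intros) (rule refl)

lemma app_recC: "app (app (app recC a) b) c = (\<Union>n\<in>a. iter n b c)"
  unfolding recC_def by (subst app_graph, intro scott_intros)+ (rule refl)

text \<open>Extensional equality of hereditarily total elements, with totality as its diagonal. At
  higher types, distinct sets may be related.\<close>

fun per :: "ty \<Rightarrow> nat set \<Rightarrow> nat set \<Rightarrow> bool" where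
  "per Nt A B \<longleftrightarrow> (\<exists>n. A = {n} \<and> B = {n})"
| "per (Fn \<rho> \<tau>) A B \<longleftrightarrow> (\<forall>X Y. per \<rho> X Y \<longrightarrow> per \<tau> (app A X) (app B Y))"

lemma per_sym: "per \<tau> A B \<Longrightarrow> per \<tau> B A"
  by (induction \<tau> arbitrary: A B) auto

lemma per_trans: "per \<tau> A B \<Longrightarrow> per \<tau> B D \<Longrightarrow> per \<tau> A D"
proof (induction \<tau> arbitrary: A B D)
  case (Fn \<rho> \<tau>)
  have "per \<tau> (app A X) (app D Y)" if XY: "per \<rho> X Y" for X Y
  proof -
    have "per \<rho> Y Y"
      using XY Fn.IH(1) per_sym by blast
    then show ?thesis
      using Fn.IH(2) Fn.prems XY by (meson per.simps(2))
  qed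
  then show ?case by simp
qed auto

lemma per_refl_left: "per \<tau> A B \<Longrightarrow> per \<tau> A A"
  using per_sym per_trans by blast

lemma per_kC: "per (Fn \<rho> (Fn \<tau> \<rho>)) kC kC"
  by (simp add: app_kC)

lemma per_sC: "per (Fn (Fn \<delta> (Fn \<rho> \<tau>)) (Fn (Fn \<delta> \<rho>) (Fn \<delta> \<tau>))) sC sC"
  by (simp add: app_sC)

lemma per_sucC: "per ty1 sucC sucC"
  by (auto simp: app_sucC)

lemma per_recC: "per (Fn Nt (Fn Nt (Fn (Fn Nt (Fn Nt Nt)) Nt))) recC recC"
proof -
  have "per Nt (iter n A B) (iter n A' B')"
    if "per Nt A A'" "per (Fn Nt (Fn Nt Nt)) B B'" for n A A' B B'
  proof (induction n)
    case (Suc n)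
    then show ?case
      using that(2) by (auto simp del: per.simps(1)) (simp add: per.simps(1))
  qed (use that in simp)
  then show ?thesis
    by (auto simp: app_recC simp del: per.simps(1) dest: per.simps(1)[THEN iffD1])
qed

section \<open>Interpretation of terms and formulas\<close>

fun ev :: "(var \<Rightarrow> nat set) \<Rightarrow> (ty \<Rightarrow> nat set) \<Rightarrow> nat set list \<Rightarrow> trm \<Rightarrow> nat set" where
  "ev \<rho> \<kappa> es (Var x) = \<rho> x"
| "ev \<rho> \<kappa> es (Bnd n) = es ! n"
| "ev \<rho> \<kappa> es (Cst \<tau>) = \<kappa> \<tau>"
| "ev \<rho> \<kappa> es Zero = {0}"
| "ev \<rho> \<kappa> es Succ = sucC"
| "ev \<rho> \<kappa> es (PiC _ _) = kC"
| "ev \<rho> \<kappa> es (SigC _ _ _) = sC"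
| "ev \<rho> \<kappa> es Rec = recC"
| "ev \<rho> \<kappa> es (s \<^bold>\<cdot> t) = app (ev \<rho> \<kappa> es s) (ev \<rho> \<kappa> es t)"

fun holds :: "(var \<Rightarrow> nat set) \<Rightarrow> (ty \<Rightarrow> nat set) \<Rightarrow> nat set list \<Rightarrow> fm \<Rightarrow> bool" where
  "holds \<rho> \<kappa> es (Eq s t) \<longleftrightarrow> ev \<rho> \<kappa> es s = ev \<rho> \<kappa> es t"
| "holds \<rho> \<kappa> es Bot \<longleftrightarrow> False"
| "holds \<rho> \<kappa> es (And A B) \<longleftrightarrow> holds \<rho> \<kappa> es A \<and> holds \<rho> \<kappa> es B"
| "holds \<rho> \<kappa> es (Or A B) \<longleftrightarrow> holds \<rho> \<kappa> es A \<or> holds \<rho> \<kappa> es B"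
| "holds \<rho> \<kappa> es (Imp A B) \<longleftrightarrow> (holds \<rho> \<kappa> es A \<longrightarrow> holds \<rho> \<kappa> es B)"
| "holds \<rho> \<kappa> es (AllB \<tau> A) \<longleftrightarrow> (\<forall>a. per \<tau> a a \<longrightarrow> holds \<rho> \<kappa> (a # es) A)"
| "holds \<rho> \<kappa> es (ExB \<tau> A) \<longleftrightarrow> (\<exists>a. per \<tau> a a \<and> holds \<rho> \<kappa> (a # es) A)"

lemma scott_ev_var: "scott (\<lambda>X. ev (\<rho>(x := X)) \<kappa> es t)"
proof (induction t)
  case (Var y)
  then show ?case
    by (cases "y = x") (auto intro: scott_intros)
qed (auto intro: scott_intros)

lemma scott_ev_cst: "scott (\<lambda>X. ev \<rho> (\<kappa>(c := X)) es t)"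
proof (induction t)
  case (Cst d)
  then show ?case
    by (cases "d = c") (auto intro: scott_intros)
qed (auto intro: scott_intros)

text \<open>The fundamental lemma of logical relations. Its diagonal case gives totality of all
  terms, the two-sided form shows that values respect \<open>per\<close>.\<close>

lemma ev_per:
  assumes "tyof \<Delta> t = Some \<tau>" "list_all2 (\<lambda>\<tau> (a, b). per \<tau> a b) \<Delta> (zip es es')"
    "length es = length es'"
    "\<And>x. per (snd x) (\<rho> x) (\<rho>' x)" "\<And>c. per c (\<kappa> c) (\<kappa> c)"
  shows "per \<tau> (ev \<rho> \<kappa> es t) (ev \<rho>' \<kappa> es' t)"
  using assms(1)
proof (induction t arbitrary: \<tau>)
  case (Bnd n)
  then show ?case
    using assms(2,3) by (auto simp: list_all2_conv_all_nth split: if_splits)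
next
  case (App s t)
  then obtain \<sigma> where "tyof \<Delta> s = Some (Fn \<sigma> \<tau>)" "tyof \<Delta> t = Some \<sigma>"
    using tyof_App by blast
  with App.IH show ?case
    by fastforce
qed (use assms per_kC per_sC per_sucC per_recC in \<open>auto simp del: per.simps(2)\<close>)

definition total_val :: "(var \<Rightarrow> nat set) \<Rightarrow> bool" where
  "total_val \<rho> \<longleftrightarrow> (\<forall>x. per (snd x) (\<rho> x) (\<rho> x))"

lemma total_valD: "total_val \<rho> \<Longrightarrow> per (snd x) (\<rho> x) (\<rho> x)"
  unfolding total_val_def by blast

abbreviation total_cst :: "(ty \<Rightarrow> nat set) \<Rightarrow> bool" where
  "total_cst \<kappa> \<equiv> (\<forall>c. per c (\<kappa> c) (\<kappa> c))"

abbreviation total_env :: "ty list \<Rightarrow> nat set list \<Rightarrow> bool" where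
  "total_env \<equiv> list_all2 (\<lambda>\<tau> a. per \<tau> a a)"

lemma total_val_upd: "total_val \<rho> \<Longrightarrow> per (snd x) a a \<Longrightarrow> total_val (\<rho>(x := a))"
  unfolding total_val_def fun_upd_apply by presburger

lemma ev_total:
  assumes "tyof \<Delta> t = Some \<tau>" "total_env \<Delta> es" "total_val \<rho>" "total_cst \<kappa>"
  shows "per \<tau> (ev \<rho> \<kappa> es t) (ev \<rho> \<kappa> es t)"
  using assms by (intro ev_per) (auto simp: list_all2_conv_all_nth total_valD)

lemma ev_env_append: "tyof \<Delta> t \<noteq> None \<Longrightarrow> length es = length \<Delta> \<Longrightarrow> ev \<rho> \<kappa> (es @ es') t = ev \<rho> \<kappa> es t"
proof (induction t)
  case (App s t)
  then have "tyof \<Delta> s \<noteq> None" "tyof \<Delta> t \<noteq> None"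
    by (auto simp only: not_None_eq tyof_App)
  with App show ?case
    by simp
qed (auto simp: nth_append split: if_splits)

lemma holds_env_append:
  "wff C \<Delta> A \<Longrightarrow> length es = length \<Delta> \<Longrightarrow> holds \<rho> \<kappa> (es @ es') A = holds \<rho> \<kappa> es A"
proof (induction A arbitrary: \<Delta> es)
  case (Eq s t)
  then show ?case
    by (simp add: wt_def ev_env_append[of \<Delta>])
next
  case (AllB \<tau> A)
  then show ?case
    using AllB.IH[of "\<tau> # \<Delta>" "a # es" for a] by simp
next
  case (ExB \<tau> A)
  then show ?case
    using ExB.IH[of "\<tau> # \<Delta>" "a # es" for a] by simp
qed auto

text \<open>The new binder is the outermost one, so its value stands at the end of the environment,
  at index \<open>length es\<close>.\<close>

lemma ev_bindt:
  "tyof \<Delta> t \<noteq> None \<Longrightarrow> length es = length \<Delta> \<Longrightarrow>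
   ev \<rho> \<kappa> (es @ [a]) (bindt (length es) x t) = ev (\<rho>(x := a)) \<kappa> es t"
proof (induction t)
  case (App s t)
  then have "tyof \<Delta> s \<noteq> None" "tyof \<Delta> t \<noteq> None"
    by (auto simp only: not_None_eq tyof_App)
  with App show ?case
    by simp
qed (auto simp: nth_append split: if_splits)

lemma holds_bind:
  "wff C \<Delta> A \<Longrightarrow> length es = length \<Delta> \<Longrightarrow>
   holds \<rho> \<kappa> (es @ [a]) (bind (length es) x A) = holds (\<rho>(x := a)) \<kappa> es A"
proof (induction A arbitrary: \<Delta> es)
  case (Eq s t)
  then show ?case
    using ev_bindt[of \<Delta> s es \<rho> \<kappa> a x] ev_bindt[of \<Delta> t es \<rho> \<kappa> a x]
    by (simp add: wt_def del: fun_upd_apply)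
next
  case (AllB \<tau> A)
  then show ?case
    using AllB.IH[of "\<tau> # \<Delta>" "a # es" for a] by simp
next
  case (ExB \<tau> A)
  then show ?case
    using ExB.IH[of "\<tau> # \<Delta>" "a # es" for a] by simp
qed auto

lemma holds_Forall:
  "wff C [] A \<Longrightarrow>
   holds \<rho> \<kappa> [] (Forall x A) \<longleftrightarrow> (\<forall>a. per (snd x) a a \<longrightarrow> holds (\<rho>(x := a)) \<kappa> [] A)"
  using holds_bind[of C "[]" A "[]" \<rho> \<kappa> _ x] by (simp add: Forall_def)

lemma holds_Exists:
  "wff C [] A \<Longrightarrow>
   holds \<rho> \<kappa> [] (Exists x A) \<longleftrightarrow> (\<exists>a. per (snd x) a a \<and> holds (\<rho>(x := a)) \<kappa> [] A)"
  using holds_bind[of C "[]" A "[]" \<rho> \<kappa> _ x] by (simp add: Exists_def)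

lemma tyof_bindt: "tyof \<Delta> t = Some \<tau> \<Longrightarrow> tyof (\<Delta> @ [snd x]) (bindt (length \<Delta>) x t) = Some \<tau>"
proof (induction t arbitrary: \<tau>)
  case (App s t)
  then show ?case
    by (fastforce simp: tyof_App simp del: tyof.simps(9))
qed (auto simp: nth_append split: if_splits)

lemma csts_bindt: "csts (bindt k x t) = csts t"
  by (induction t) auto

lemma wff_bind: "wff C \<Delta> A \<Longrightarrow> wff C (\<Delta> @ [snd x]) (bind (length \<Delta>) x A)"
proof (induction A arbitrary: \<Delta>)
  case (Eq s t)
  then show ?case
    by (simp add: wt_def tyof_bindt csts_bindt)
next
  case (AllB \<tau> A)
  then show ?case
    using AllB.IH[of "\<tau> # \<Delta>"] by simp
next
  case (ExB \<tau> A)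
  then show ?case
    using ExB.IH[of "\<tau> # \<Delta>"] by simp
qed auto

lemma wff_Forall: "wff C [] A \<Longrightarrow> wff C [] (Forall x A)"
  using wff_bind[of C "[]" A x] by (simp add: Forall_def)

lemma wff_Exists: "wff C [] A \<Longrightarrow> wff C [] (Exists x A)"
  using wff_bind[of C "[]" A x] by (simp add: Exists_def)

lemma tyof_weaken: "tyof [] t = Some \<tau> \<Longrightarrow> tyof \<Delta> t = Some \<tau>"
proof (induction t arbitrary: \<tau>)
  case (App s t)
  then show ?case
    by (fastforce simp: tyof_App simp del: tyof.simps(9))
qed auto

lemma tyof_substt: "tyof [] r = Some (snd x) \<Longrightarrow> tyof \<Delta> (substt x r t) = tyof \<Delta> t"
  using tyof_weaken[of r "snd x" \<Delta>] by (induction t) (simp_all split: option.split ty.split)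

lemma wff_subst_UNIV:
  "tyof [] r = Some (snd x) \<Longrightarrow> wff UNIV \<Delta> (subst x r A) \<longleftrightarrow> wff UNIV \<Delta> A"
  by (induction A arbitrary: \<Delta>) (auto simp: wt_def tyof_substt)

lemma wff_mono: "wff C \<Delta> A \<Longrightarrow> C \<subseteq> D \<Longrightarrow> wff D \<Delta> A"
  by (induction A arbitrary: \<Delta>) (auto simp: wt_def)

lemma ev_weaken: "tyof [] t = Some \<tau> \<Longrightarrow> ev \<rho> \<kappa> es t = ev \<rho> \<kappa> [] t"
  using ev_env_append[of "[]" t "[]" \<rho> \<kappa> es] by simp

lemma ev_substt:
  "tyof [] r = Some \<tau> \<Longrightarrow> ev \<rho> \<kappa> es (substt x r t) = ev (\<rho>(x := ev \<rho> \<kappa> [] r)) \<kappa> es t"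
  using ev_weaken[of r \<tau> \<rho> \<kappa> es] by (induction t) simp_all

lemma holds_subst:
  "tyof [] r = Some \<tau> \<Longrightarrow> holds \<rho> \<kappa> es (subst x r A) = holds (\<rho>(x := ev \<rho> \<kappa> [] r)) \<kappa> es A"
  by (induction A arbitrary: es) (auto simp: ev_substt)

lemma bind_fresh: "x \<notin> fvf A \<Longrightarrow> bind k x A = A"
  by (induction A arbitrary: k) (auto simp: bindt_fresh)

lemma ev_cong: "(\<And>x. x \<in> fv t \<Longrightarrow> \<rho> x = \<rho>' x) \<Longrightarrow> ev \<rho> \<kappa> es t = ev \<rho>' \<kappa> es t"
  by (induction t) auto

lemma holds_cong: "(\<And>x. x \<in> fvf A \<Longrightarrow> \<rho> x = \<rho>' x) \<Longrightarrow> holds \<rho> \<kappa> es A = holds \<rho>' \<kappa> es A"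
proof (induction A arbitrary: es)
  case (Eq s t)
  then show ?case
    using ev_cong[of s \<rho> \<rho>'] ev_cong[of t \<rho> \<rho>'] by simp
qed auto

lemma ev_lift: "ev \<rho> \<kappa> (a # es) (lift t) = ev \<rho> \<kappa> es t"
  by (induction t) auto

lemma tyof_lift: "tyof (\<tau> # \<Delta>) (lift t) = tyof \<Delta> t"
  by (induction t) (simp_all split: option.split ty.split)

text \<open>The formula compares \<open>s\<close> and \<open>t\<close> at equal arguments only,
  whereas \<open>per\<close> admits related ones; totality of \<open>t\<close> and transitivity
  close the gap.\<close>

lemma holds_eqt:
  assumes "total_val \<rho>" "total_cst \<kappa>"
  shows "total_env \<Delta> es \<Longrightarrow> tyof \<Delta> s = Some \<tau> \<Longrightarrow> tyof \<Delta> t = Some \<tau> \<Longrightarrow>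
    holds \<rho> \<kappa> es (eqt \<tau> s t) \<longleftrightarrow> per \<tau> (ev \<rho> \<kappa> es s) (ev \<rho> \<kappa> es t)"
proof (induction \<tau> arbitrary: \<Delta> es s t)
  case Nt
  then show ?case
    using ev_total[OF Nt(2,1) assms] ev_total[OF Nt(3,1) assms] by auto
next
  case (Fn \<sigma> \<tau>)
  let ?s = "ev \<rho> \<kappa> es s" and ?t = "ev \<rho> \<kappa> es t"
  have "holds \<rho> \<kappa> es (eqt (Fn \<sigma> \<tau>) s t) \<longleftrightarrow> (\<forall>a. per \<sigma> a a \<longrightarrow> per \<tau> (app ?s a) (app ?t a))"
    using Fn.prems by (auto simp: Fn.IH(2)[of "\<sigma> # \<Delta>"] ev_lift tyof_lift)
  also have "\<dots> \<longleftrightarrow> per (Fn \<sigma> \<tau>) ?s ?t"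
  proof
    assume a: "\<forall>a. per \<sigma> a a \<longrightarrow> per \<tau> (app ?s a) (app ?t a)"
    have t: "per (Fn \<sigma> \<tau>) ?t ?t"
      using Fn.prems assms by (intro ev_total)
    have "per \<tau> (app ?s X) (app ?t Y)" if XY: "per \<sigma> X Y" for X Y
    proof (rule per_trans)
      show "per \<tau> (app ?s X) (app ?t X)"
        using a per_refl_left[OF XY] by blast
      show "per \<tau> (app ?t X) (app ?t Y)"
        using t XY by simp
    qed
    then show "per (Fn \<sigma> \<tau>) ?s ?t"
      by simp
  qed simp
  finally show ?case .
qed

lemma logical_axiom_holds:
  assumes "logical_axiom A" "wff C [] A" "total_val \<rho>" "total_cst \<kappa>"
  shows "holds \<rho> \<kappa> [] A"
  using assms(1,2)
proof cases
  case (10 t x B)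
  then have t: "tyof [] t = Some (snd x)"
    by (simp add: wt_def)
  \<comment> \<open>Well-formedness of \<open>B\<close> is recovered from its instance; over
    \<open>UNIV\<close> the constants of \<open>t\<close> cannot interfere.\<close>
  have B: "wff UNIV [] B"
    using assms(2) wff_mono[of C "[]" "subst x t B" UNIV] wff_subst_UNIV[OF t] by (simp add: 10)
  show ?thesis
    using ev_total[OF t _ assms(3,4)] by (simp add: 10 holds_Forall[OF B] holds_subst[OF t])
next
  case (11 t x B)
  then have t: "tyof [] t = Some (snd x)"
    by (simp add: wt_def)
  have B: "wff UNIV [] B"
    using assms(2) wff_mono[of C "[]" "subst x t B" UNIV] wff_subst_UNIV[OF t] by (simp add: 11)
  show ?thesis
    using ev_total[OF t _ assms(3,4)] by (auto simp: 11 holds_Exists[OF B] holds_subst[OF t])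
next
  case (12 x B D)
  then have "wff C [] B" using assms(2) by simp
  then show ?thesis
    using 12 holds_env_append[of C "[]" B "[]" \<rho> \<kappa>] by (auto simp: Forall_def bind_fresh)
next
  case (13 x B D)
  then have "wff C [] B" using assms(2) by simp
  then show ?thesis
    using 13 holds_env_append[of C "[]" B "[]" \<rho> \<kappa>]
    by (auto simp: Forall_def Exists_def bind_fresh)
qed auto

text \<open>Continuity at \<open>X\<close>, among total arguments, of a map into a discrete
  space.\<close>

definition locally_constant :: "ty \<Rightarrow> nat set \<Rightarrow> (nat set \<Rightarrow> 'a) \<Rightarrow> bool" where
  "locally_constant \<tau> X \<Phi> \<longleftrightarrow>
     (\<exists>e. finite e \<and> e \<subseteq> X \<and> (\<forall>Y. per \<tau> Y Y \<longrightarrow> e \<subseteq> Y \<longrightarrow> \<Phi> Y = \<Phi> X))"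

lemma locally_constant_const: "locally_constant \<tau> X (\<lambda>Y. c)"
  unfolding locally_constant_def by blast

lemma locally_constant_map2:
  assumes "locally_constant \<tau> X \<Phi>" "locally_constant \<tau> X \<Psi>"
  shows "locally_constant \<tau> X (\<lambda>Y. h (\<Phi> Y) (\<Psi> Y))"
proof -
  obtain e where e: "finite e" "e \<subseteq> X" "\<And>Y. per \<tau> Y Y \<Longrightarrow> e \<subseteq> Y \<Longrightarrow> \<Phi> Y = \<Phi> X"
    using assms(1) unfolding locally_constant_def by blast
  obtain d where d: "finite d" "d \<subseteq> X" "\<And>Y. per \<tau> Y Y \<Longrightarrow> d \<subseteq> Y \<Longrightarrow> \<Psi> Y = \<Psi> X"
    using assms(2) unfolding locally_constant_def by blast
  have "h (\<Phi> Y) (\<Psi> Y) = h (\<Phi> X) (\<Psi> X)" if "per \<tau> Y Y" "e \<union> d \<subseteq> Y" for Y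
    using e(3)[of Y] d(3)[of Y] that by simp
  then show ?thesis
    unfolding locally_constant_def using e(1,2) d(1,2) by (intro exI[of _ "e \<union> d"]) simp
qed

text \<open>At total arguments the value is a singleton, so once a finite part of \<open>X\<close>
  puts \<open>n\<close> into it, it can only be \<open>{n}\<close>.\<close>

lemma ev_locally_constant:
  assumes t: "tyof [] t = Some Nt" and \<rho>: "total_val \<rho>" and \<kappa>: "total_cst \<kappa>"
    and X: "per (snd x) X X"
  shows "locally_constant (snd x) X (\<lambda>Y. ev (\<rho>(x := Y)) \<kappa> [] t)"
proof -
  let ?v = "\<lambda>X. ev (\<rho>(x := X)) \<kappa> [] t"
  have single: "\<exists>n. ?v Y = {n}" if "per (snd x) Y Y" for Y
    using ev_total[OF t _ total_val_upd[OF \<rho> that] \<kappa>] by (simp del: fun_upd_apply)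
  obtain n where n: "?v X = {n}"
    using single[OF X] by blast
  obtain e where e: "finite e" "e \<subseteq> X" "n \<in> ?v e"
    using scott_finite[OF scott_ev_var[of \<rho> x \<kappa> "[]" t], of n X] n by auto
  have "?v Y = ?v X" if "per (snd x) Y Y" "e \<subseteq> Y" for Y
    using single[OF that(1)] scott_mono[OF scott_ev_var[of \<rho> x \<kappa> "[]" t] that(2)] e(3) n by auto
  then show ?thesis
    unfolding locally_constant_def using e(1,2) by blast
qed

lemma qfree_locally_constant:
  assumes \<rho>: "total_val \<rho>" and \<kappa>: "total_cst \<kappa>" and X: "per (snd x) X X"
  shows "qfree A \<Longrightarrow> wff UNIV [] A \<Longrightarrow> locally_constant (snd x) X (\<lambda>Y. holds (\<rho>(x := Y)) \<kappa> [] A)"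
proof (induction A)
  case (Eq s t)
  then have "tyof [] s = Some Nt" "tyof [] t = Some Nt"
    by (auto simp: wt_def)
  then show ?case
    unfolding holds.simps
    by (intro locally_constant_map2[where h = "(=)"] ev_locally_constant \<rho> \<kappa> X)
next
  case Bot
  then show ?case by (simp add: locally_constant_const)
next
  case (And A B)
  show ?case
    unfolding holds.simps
    by (rule locally_constant_map2[where h = "(\<and>)"]) (use And in \<open>simp_all del: fun_upd_apply\<close>)
next
  case (Or A B)
  show ?case
    unfolding holds.simps
    by (rule locally_constant_map2[where h = "(\<or>)"]) (use Or in \<open>simp_all del: fun_upd_apply\<close>)
next
  case (Imp A B)
  show ?case
    unfolding holds.simps
    by (rule locally_constant_map2[where h = "(\<longrightarrow>)"]) (use Imp in \<open>simp_all del: fun_upd_apply\<close>)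
qed auto

lemma qfree_extensional:
  assumes \<rho>: "total_val \<rho>" and \<kappa>: "total_cst \<kappa>" and XY: "per (snd x) X Y"
  shows "qfree A \<Longrightarrow> wff UNIV [] A \<Longrightarrow>
    holds (\<rho>(x := X)) \<kappa> [] A = holds (\<rho>(x := Y)) \<kappa> [] A"
proof (induction A)
  case (Eq s t)
  have "ev (\<rho>(x := X)) \<kappa> [] r = ev (\<rho>(x := Y)) \<kappa> [] r" if "tyof [] r = Some Nt" for r
  proof -
    have "per (snd v) ((\<rho>(x := X)) v) ((\<rho>(x := Y)) v)" for v
      using total_valD[OF \<rho>] XY by simp
    then have "per Nt (ev (\<rho>(x := X)) \<kappa> [] r) (ev (\<rho>(x := Y)) \<kappa> [] r)"
      using \<kappa> by (intro ev_per[OF that]) simp_all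
    then show ?thesis by auto
  qed
  with Eq show ?case
    by (simp add: wt_def del: fun_upd_apply)
qed auto

text \<open>That \<open>\<mu> X\<close> is the least witness depends only on the instances at
  \<open>n \<le> \<mu> X\<close>. These are finitely many locally constant conditions, so the least
  witness is continuous in \<open>X\<close>.\<close>

lemma choice_holds:
  assumes \<rho>: "total_val \<rho>" and \<kappa>: "total_cst \<kappa>"
    and A: "qfree A" "wff UNIV [] A" and x: "snd x = ty1" and y: "snd y = Nt"
    and ex: "\<And>X. per ty1 X X \<Longrightarrow> \<exists>n. holds (\<rho>(x := X, y := {n})) \<kappa> [] A"
  shows "\<exists>Z. per (Fn ty1 Nt) Z Z \<and>
    (\<forall>X. per ty1 X X \<longrightarrow> holds (\<rho>(x := X, y := app Z X)) \<kappa> [] A)"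
proof -
  have xy: "x \<noteq> y"
    using x y by auto
  define P where "P X n = holds (\<rho>(x := X, y := {n})) \<kappa> [] A" for X n
  define \<mu> where "\<mu> X = (LEAST n. P X n)" for X
  txt \<open>Quantifying over all total \<open>X\<close> makes \<open>Z\<close> a graph of the least-witness functional for free; that it
    is total is the continuity of \<open>A\<close>.\<close>
  define Z where "Z = {prod_encode (set_encode e, n) | e n.
    finite e \<and> (\<forall>X. per ty1 X X \<longrightarrow> e \<subseteq> X \<longrightarrow> \<mu> X = n)}"
  have \<rho>n: "total_val (\<rho>(y := {n}))" for n
    using \<rho> y by (intro total_val_upd) simp_all
  have P_swap: "P X n = holds ((\<rho>(y := {n}))(x := X)) \<kappa> [] A" for X n
    using xy by (simp add: P_def fun_upd_twist)
  have loc: "\<exists>e. finite e \<and> e \<subseteq> X \<and> (\<forall>Y. per ty1 Y Y \<longrightarrow> e \<subseteq> Y \<longrightarrow> P Y n = P X n)"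
    if "per ty1 X X" for X n
    using qfree_locally_constant[OF \<rho>n \<kappa> _ A, of x X n] that
    unfolding P_swap locally_constant_def x by (simp only:)
  have \<mu>_ext: "\<mu> X = \<mu> Y" if "per ty1 X Y" for X Y
  proof -
    have "P X n = P Y n" for n
      using qfree_extensional[OF \<rho>n \<kappa> _ A, of x X Y n] that unfolding P_swap x by (simp only:)
    then show ?thesis by (simp add: \<mu>_def)
  qed
  have \<mu>: "P X (\<mu> X)" if "per ty1 X X" for X
    unfolding \<mu>_def by (rule LeastI_ex) (use ex[OF that] in \<open>simp add: P_def\<close>)
  have app_Z: "app Z X = {\<mu> X}" if X: "per ty1 X X" for X
  proof -
    have "\<exists>E. \<forall>n. finite (E n) \<and> E n \<subseteq> X \<and> (\<forall>Y. per ty1 Y Y \<longrightarrow> E n \<subseteq> Y \<longrightarrow> P Y n = P X n)"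
      using loc[OF X] by (intro choice allI)
    then obtain E where "\<forall>n. finite (E n) \<and> E n \<subseteq> X \<and>
        (\<forall>Y. per ty1 Y Y \<longrightarrow> E n \<subseteq> Y \<longrightarrow> P Y n = P X n)"
      by (rule exE)
    then have E: "\<And>n. finite (E n)" "\<And>n. E n \<subseteq> X"
      "\<And>n Y. per ty1 Y Y \<Longrightarrow> E n \<subseteq> Y \<Longrightarrow> P Y n = P X n"
      by (simp_all del: per.simps)
    let ?e = "\<Union>n\<le>\<mu> X. E n"
    have "\<mu> Y = \<mu> X" if Y: "per ty1 Y Y" "?e \<subseteq> Y" for Y
    proof -
      have eq: "P Y n = P X n" if "n \<le> \<mu> X" for n
        using E(3)[OF Y(1), of n] Y(2) that by blast
      show ?thesis
        unfolding \<mu>_def[of Y]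
      proof (rule Least_equality)
        show "P Y (\<mu> X)"
          using \<mu>[OF X] eq by simp
        fix n assume "P Y n"
        show "\<mu> X \<le> n"
        proof (rule ccontr)
          assume n: "\<not> \<mu> X \<le> n"
          then have "P X n"
            using eq[of n] \<open>P Y n\<close> by simp
          then show False
            using n Least_le[of "P X" n] by (simp add: \<mu>_def)
        qed
      qed
    qed
    then have "prod_encode (set_encode ?e, \<mu> X) \<in> Z"
      using E(1) unfolding Z_def by blast
    moreover have "finite ?e" "?e \<subseteq> X"
      using E(1,2) by auto
    ultimately have "\<mu> X \<in> app Z X"
      unfolding app_def by blast
    \<comment> \<open>\<open>X\<close> is itself a total superset of the finite set that contributed
      \<open>n\<close>.\<close>
    moreover have "n = \<mu> X" if "n \<in> app Z X" for n
      using that X by (auto simp: app_def Z_def set_encode_eq)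
    ultimately show ?thesis by blast
  qed
  have "per (Fn ty1 Nt) Z Z"
  proof -
    have "per Nt (app Z X) (app Z Y)" if XY: "per ty1 X Y" for X Y
    proof -
      have "app Z X = {\<mu> X}" "app Z Y = {\<mu> X}"
        using app_Z[OF per_refl_left[OF XY]] app_Z[OF per_refl_left[OF per_sym[OF XY]]] \<mu>_ext[OF XY]
        by simp_all
      then show ?thesis by simp
    qed
    then show ?thesis by (simp only: per.simps(2)[of ty1 Nt]) blast
  qed
  moreover have "holds (\<rho>(x := X, y := app Z X)) \<kappa> [] A" if "per ty1 X X" for X
    using \<mu>[OF that] app_Z[OF that] by (simp add: P_def)
  ultimately show ?thesis by blast
qed

lemma iRCA0\<omega>_holds:
  assumes "A \<in> iRCA0\<omega>" "wff C [] A" and \<rho>: "total_val \<rho>" and \<kappa>: "total_cst \<kappa>"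
  shows "holds \<rho> \<kappa> [] A"
  using assms(1,2)
proof cases
  case (extensionality r \<sigma> \<tau> s t)
  then have ty: "tyof [] r = Some (Fn \<sigma> \<tau>)" "tyof [] s = Some \<sigma>" "tyof [] t = Some \<sigma>"
    by (simp_all add: wt_def)
  then have ty': "tyof [] (r \<^bold>\<cdot> s) = Some \<tau>" "tyof [] (r \<^bold>\<cdot> t) = Some \<tau>"
    by simp_all
  have "per (Fn \<sigma> \<tau>) (ev \<rho> \<kappa> [] r) (ev \<rho> \<kappa> [] r)"
    using ev_total[OF ty(1) _ \<rho> \<kappa>] by simp
  then show ?thesis
    using holds_eqt[OF \<rho> \<kappa> _ ty(2,3)] holds_eqt[OF \<rho> \<kappa> _ ty'] by (simp add: extensionality)
next
  case (succ_neq_zero t)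
  then show ?thesis by (auto simp: app_sucC)
next
  case (succ_inject s t)
  then show ?thesis by (auto simp: app_sucC inj_image_eq_iff)
next
  case (projector s \<sigma> t \<tau>)
  then have ty: "tyof [] (PiC \<sigma> \<tau> \<^bold>\<cdot> s \<^bold>\<cdot> t) = Some \<sigma>" "tyof [] s = Some \<sigma>"
    by (simp_all add: wt_def)
  show ?thesis
    using holds_eqt[OF \<rho> \<kappa> _ ty] ev_total[OF ty(2) _ \<rho> \<kappa>] by (simp add: projector app_kC)
next
  case (combinator r \<delta> \<sigma> \<tau> s t)
  then have ty: "tyof [] (SigC \<delta> \<sigma> \<tau> \<^bold>\<cdot> r \<^bold>\<cdot> s \<^bold>\<cdot> t) = Some \<tau>" "tyof [] (r \<^bold>\<cdot> t \<^bold>\<cdot> (s \<^bold>\<cdot> t)) = Some \<tau>"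
    by (simp_all add: wt_def)
  show ?thesis
    using holds_eqt[OF \<rho> \<kappa> _ ty] ev_total[OF ty(2) _ \<rho> \<kappa>] by (simp add: combinator app_sC)
next
  case (rec_zero s t)
  then show ?thesis by (simp add: app_recC)
next
  case (rec_succ r s t)
  \<comment> \<open>This axiom carries no typing premise. Well-formedness of the instance gives
    \<open>r\<close> type 0, so its value is a singleton and the unions from \<open>app_recC\<close>
    have one member.\<close>
  then have "wt C [] (Rec \<^bold>\<cdot> (Succ \<^bold>\<cdot> r) \<^bold>\<cdot> s \<^bold>\<cdot> t) Nt"
    using assms(2) by simp
  then have "tyof [] r = Some Nt"
    by (simp add: wt_def split: option.splits ty.splits if_splits)
  then obtain n where "ev \<rho> \<kappa> [] r = {n}"
    using ev_total[OF _ _ \<rho> \<kappa>, of "[]" r Nt "[]"] by auto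
  then show ?thesis
    by (simp add: rec_succ app_recC app_sucC)
next
  case (qf_induction B x)
  have z: "tyof [] Zero = Some Nt" and s: "tyof [] (Succ \<^bold>\<cdot> Var x) = Some Nt"
    using qf_induction by simp_all
  have B': "wff UNIV [] (Imp B (subst x (Succ \<^bold>\<cdot> Var x) B))"
    using qf_induction wff_subst_UNIV[of "Succ \<^bold>\<cdot> Var x" x "[]" B] s by simp
  have "holds (\<rho>(x := {n})) \<kappa> [] B"
    if "holds (\<rho>(x := {0})) \<kappa> [] B"
      and step: "\<forall>a. (\<exists>n. a = {n}) \<longrightarrow> holds (\<rho>(x := a)) \<kappa> [] B \<longrightarrow> holds (\<rho>(x := Suc ` a)) \<kappa> [] B"
    for n
  proof (induction n)
    case (Suc n)
    then show ?case
      using step[rule_format, of "{n}"] by (simp del: fun_upd_apply)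
  qed (fact that)
  then show ?thesis
    using qf_induction(4)
    by (auto simp: qf_induction(1) holds_Forall[OF qf_induction(3)] holds_Forall[OF B']
        holds_subst[OF z] holds_subst[OF s] app_sucC fun_upd_same simp del: fun_upd_apply tyof.simps)
next
  case (qf_choice B x y z)
  note B = qf_choice(3)
  have t: "tyof [] (Var z \<^bold>\<cdot> Var x) = Some Nt"
    using qf_choice by simp
  have B': "wff UNIV [] (subst y (Var z \<^bold>\<cdot> Var x) B)"
    using wff_subst_UNIV[of "Var z \<^bold>\<cdot> Var x" y] t B qf_choice by simp
  have zx: "z \<noteq> x"
    using qf_choice by auto
  show ?thesis
    unfolding qf_choice(1) holds.simps
  proof
    assume "holds \<rho> \<kappa> [] (Forall x (Exists y B))"
    then have "\<exists>n. holds (\<rho>(x := X, y := {n})) \<kappa> [] B" if "per ty1 X X" for X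
      using that qf_choice(4,5)
      by (auto simp: holds_Forall[OF wff_Exists[OF B]] holds_Exists[OF B] simp del: fun_upd_apply per.simps(2))
    from choice_holds[OF \<rho> \<kappa> qf_choice(2,3,4,5) this] obtain Z where Z: "per (Fn ty1 Nt) Z Z"
      "\<And>X. per ty1 X X \<Longrightarrow> holds (\<rho>(x := X, y := app Z X)) \<kappa> [] B"
      by blast
    have "holds (\<rho>(z := Z, x := X)) \<kappa> [] (subst y (Var z \<^bold>\<cdot> Var x) B)" if "per ty1 X X" for X
    proof -
      have "holds (\<rho>(z := Z, x := X)) \<kappa> [] (subst y (Var z \<^bold>\<cdot> Var x) B) =
        holds (\<rho>(z := Z, x := X, y := app Z X)) \<kappa> [] B"
        using zx by (simp add: holds_subst[OF t])
      also have "\<dots> = holds (\<rho>(x := X, y := app Z X)) \<kappa> [] B"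
        by (rule holds_cong) (use qf_choice(7) in auto)
      finally show ?thesis using Z(2)[OF that] by simp
    qed
    then show "holds \<rho> \<kappa> [] (Exists z (Forall x (subst y (Var z \<^bold>\<cdot> Var x) B)))"
      using Z(1) qf_choice(4,6)
      by (auto simp: holds_Forall[OF B'] holds_Exists[OF wff_Forall[OF B']]
          simp del: fun_upd_apply per.simps(2))
  qed
qed auto

section \<open>Soundness of deductions\<close>

lemma deduces_wff: "deduces T C G \<Gamma> A \<Longrightarrow> wff C [] A"
  by (induction rule: deduces.induct) (auto simp: wff_Forall)

text \<open>The ban on generalizing over \<open>G\<close> enters here: assumptions must hold for
  just those valuations that agree with \<open>\<rho>\<close> on \<open>G\<close>, and
  \<open>Gen\<close> stays among them, as it changes only a variable outside
  \<open>G\<close>.\<close>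

lemma soundness:
  assumes "deduces iRCA0\<omega> C G \<Gamma> A" and \<kappa>: "total_cst \<kappa>"
    and \<Gamma>: "\<And>B \<rho>'. B \<in> \<Gamma> \<Longrightarrow> total_val \<rho>' \<Longrightarrow> \<forall>x\<in>G. \<rho>' x = \<rho> x \<Longrightarrow> holds \<rho>' \<kappa> [] B"
  shows "total_val \<rho>' \<Longrightarrow> \<forall>x\<in>G. \<rho>' x = \<rho> x \<Longrightarrow> holds \<rho>' \<kappa> [] A"
  using assms(1)
proof (induction arbitrary: \<rho>')
  case (Logical A)
  then show ?case
    using logical_axiom_holds \<kappa> by blast
next
  case (Axiom A)
  then show ?case
    using iRCA0\<omega>_holds \<kappa> by blast
next
  case (Assumption A)
  then show ?case
    using \<Gamma> by blast
next
  case (MP A B)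
  then show ?case
    by simp
next
  case (Gen A x)
  then have "holds (\<rho>'(x := a)) \<kappa> [] A" if "per (snd x) a a" for a
    using that Gen.hyps Gen.prems by (intro Gen.IH total_val_upd) auto
  then show ?case
    by (simp add: holds_Forall[OF deduces_wff[OF Gen.hyps(1)]] del: fun_upd_apply)
qed

section \<open>Ramsey's theorem in the model\<close>

text \<open>The laws for \<open>kC\<close> and \<open>sC\<close> are plain equations between sets,
  valid at all arguments, so abstraction works for arbitrary \<open>a\<close> and untyped
  \<open>t\<close>.\<close>

lemma app_ev_lam: "app (ev \<rho> \<kappa> es (lam x t)) a = ev (\<rho>(x := a)) \<kappa> es t"
  by (induction t) (auto simp: app_kC app_sC)

lemma ev_plus_t: "app (app (ev \<rho> \<kappa> es plus_t) {a}) {b} = {a + b}"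
proof -
  have "iter b {a} (ev \<rho> \<kappa> es (lam vp (lam vq (Succ \<^bold>\<cdot> Var vp)))) = {a + b}" for \<rho>
    by (induction b) (simp_all add: app_ev_lam app_sucC del: lam.simps)
  then show ?thesis
    by (simp add: plus_t_def app_ev_lam app_recC del: lam.simps)
qed

lemma ev_pred_t: "app (ev \<rho> \<kappa> es pred_t) {a} = {a - 1}"
proof -
  have "iter a {0} (ev \<rho> \<kappa> es (lam vp (lam vq (Var vq)))) = {a - 1}" for \<rho>
    by (cases a) (simp_all add: app_ev_lam del: lam.simps)
  then show ?thesis
    by (simp add: pred_t_def app_ev_lam app_recC del: lam.simps)
qed

lemma ev_monus_t: "app (app (ev \<rho> \<kappa> es monus_t) {a}) {b} = {a - b}"
proof -
  have "iter b {a} (ev \<rho> \<kappa> es (lam vp (lam vq (pred_t \<^bold>\<cdot> Var vp)))) = {a - b}" for \<rho>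
    by (induction b) (simp_all add: app_ev_lam ev_pred_t del: lam.simps)
  then show ?thesis
    by (simp add: monus_t_def app_ev_lam app_recC del: lam.simps)
qed

lemma ev_tri_t: "app (ev \<rho> \<kappa> es tri_t) {a} = {triangle a}"
proof -
  have "iter a {0} (ev \<rho> \<kappa> es (lam vp (lam vq (plus_t \<^bold>\<cdot> Var vp \<^bold>\<cdot> (Succ \<^bold>\<cdot> Var vq))))) = {triangle a}"
    for \<rho>
    by (induction a) (simp_all add: app_ev_lam app_sucC ev_plus_t del: lam.simps)
  then show ?thesis
    by (simp add: tri_t_def app_ev_lam app_recC del: lam.simps)
qed

lemma ev_pair_t: "app (app (ev \<rho> \<kappa> es pair_t) {a}) {b} = {prod_encode (a, b)}"
  by (simp add: pair_t_def app_ev_lam ev_plus_t ev_tri_t prod_encode_def del: lam.simps)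

lemma ev_numeral_t: "ev \<rho> \<kappa> es (numeral_t k) = {k}"
  by (induction k) (simp_all add: app_sucC)

lemma ev_trunc_t: "app (ev \<rho> \<kappa> es (trunc_t k)) {a} = {trunc k a}"
proof -
  have "iter n {0} (ev \<rho> \<kappa> es (lam vp (lam vq (Var va)))) = (if n = 0 then {0} else \<rho> va)" for n \<rho>
    by (cases n) (simp_all add: app_ev_lam del: lam.simps)
  then show ?thesis
    by (simp add: trunc_t_def app_ev_lam app_recC ev_monus_t ev_numeral_t trunc_def del: lam.simps)
qed

lemma holds_Lt:
  "ev \<rho> \<kappa> es s = {a} \<Longrightarrow> ev \<rho> \<kappa> es t = {b} \<Longrightarrow> holds \<rho> \<kappa> es (Lt s t) \<longleftrightarrow> a < b"
  by (auto simp: Lt_def app_sucC ev_monus_t)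

section \<open>The meaning of the Ramsey formulas and of their presentations\<close>

abbreviation vf :: var where "vf \<equiv> (0, ty1)"
abbreviation vx :: var where "vx \<equiv> (1, ty1)"

text \<open>The body under the existential quantifier of \<open>RT2 k\<close>, whose
  \<open>m\<close>, \<open>i\<close>, \<open>j\<close> are \<open>va\<close>, \<open>vb\<close>,
  \<open>vp\<close>.\<close>

definition RT2_matrix :: "nat \<Rightarrow> fm" where
  "RT2_matrix k = Forall va
     (And (Lt (Var vx \<^bold>\<cdot> Var va) (Var vx \<^bold>\<cdot> (Succ \<^bold>\<cdot> Var va)))
       (Forall vb (Forall vp
         (Imp (And (Lt Zero (Var vb)) (And (Lt (Var vb) (Var vp)) (Lt (Var vp) (Var va))))
           (Eq (trunc_t k \<^bold>\<cdot> (Var vf \<^bold>\<cdot> (pair_t \<^bold>\<cdot> (Var vx \<^bold>\<cdot> Var vb) \<^bold>\<cdot> (Var vx \<^bold>\<cdot> Var vp))))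
               (Var vx \<^bold>\<cdot> Zero))))))"

lemma RT2_eq: "RT2 k = Forall vf (Imp (Eq Zero Zero) (Exists vx (RT2_matrix k)))"
  by (simp add: RT2_def RT2_matrix_def Let_def)

lemma tyof_arith:
  "tyof \<Delta> monus_t = Some (Fn Nt (Fn Nt Nt))" "csts monus_t = {}"
  "tyof \<Delta> pair_t = Some (Fn Nt (Fn Nt Nt))" "csts pair_t = {}"
  "tyof \<Delta> (trunc_t k) = Some (Fn Nt Nt)" "csts (trunc_t k) = {}"
  using wt_monus_t[of "{}" \<Delta>] wt_pair_t[of "{}" \<Delta>] wt_trunc_t[of "{}" \<Delta> k]
  by (simp_all add: wt_def)

lemma wff_RT2_matrix: "wff {} [] (RT2_matrix k)"
  unfolding RT2_matrix_def
  by (intro wff_Forall wff.simps(3,5)[THEN iffD2] conjI) (simp_all add: Lt_def wt_def tyof_arith wff_Forall)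

lemma holds_RT2_matrix:
  assumes f: "\<And>n. app (\<rho> vf) {n} = {f n}" and x: "\<And>n. app (\<rho> vx) {n} = {x n}"
  shows "holds \<rho> \<kappa> [] (RT2_matrix k) \<longleftrightarrow> homogeneous k f x"
proof -
  let ?I = "Imp (And (Lt Zero (Var vb)) (And (Lt (Var vb) (Var vp)) (Lt (Var vp) (Var va))))
           (Eq (trunc_t k \<^bold>\<cdot> (Var vf \<^bold>\<cdot> (pair_t \<^bold>\<cdot> (Var vx \<^bold>\<cdot> Var vb) \<^bold>\<cdot> (Var vx \<^bold>\<cdot> Var vp))))
               (Var vx \<^bold>\<cdot> Zero))"
  let ?L = "Lt (Var vx \<^bold>\<cdot> Var va) (Var vx \<^bold>\<cdot> (Succ \<^bold>\<cdot> Var va))"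
  have I: "wff {} [] ?I" and L: "wff {} [] ?L"
    by (simp_all add: Lt_def wt_def tyof_arith)
  have M: "wff {} [] (And ?L (Forall vb (Forall vp ?I)))"
    using L wff_Forall[OF wff_Forall[OF I]] by simp
  have L': "holds (\<rho>(va := {m})) \<kappa> [] ?L \<longleftrightarrow> x m < x (Suc m)" for m
    by (rule holds_Lt) (simp_all add: x app_sucC del: One_nat_def)
  have I': "holds (\<rho>(va := {m}, vb := {i}, vp := {j})) \<kappa> [] ?I \<longleftrightarrow>
      (0 < i \<and> i < j \<and> j < m \<longrightarrow> trunc k (f (prod_encode (x i, x j))) = x 0)" for m i j
    by (simp add: f x holds_Lt[where a = 0 and b = i] holds_Lt[where a = i and b = j]
        holds_Lt[where a = j and b = m] ev_pair_t ev_trunc_t del: One_nat_def)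
  have all: "(\<forall>a. per Nt a a \<longrightarrow> P a) \<longleftrightarrow> (\<forall>n. P {n})" for P
    by auto
  show ?thesis
    unfolding RT2_matrix_def holds_Forall[OF M] holds.simps(3) holds_Forall[OF wff_Forall[OF I]]
      holds_Forall[OF I] snd_conv all L' I' homogeneous_def ..
qed

text \<open>A typical use may present \<open>RT2 k\<close> with other variables. Formulas are
  identified up to renaming, so the two bodies coincide after binding, and evaluating the common
  body in the environment \<open>[b, a]\<close> gives both sides.\<close>

lemma typical_formula_matrix:
  assumes eq: "RT2 k = Forall u (Imp q1 (Exists v q2))"
    and q2: "wff {} [] q2" and "u \<noteq> v"
  shows "snd u = ty1" "snd v = ty1"
    and "holds (\<rho>(u := a, v := b)) \<kappa> [] q2 \<longleftrightarrow> holds (\<rho>(vf := a, vx := b)) \<kappa> [] (RT2_matrix k)"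
proof -
  have *: "bind 1 u (bind 0 v q2) = bind 1 vf (bind 0 vx (RT2_matrix k))"
    and ty: "snd u = ty1" "snd v = ty1"
    using eq unfolding RT2_eq Forall_def Exists_def bind.simps fm.inject snd_conv One_nat_def
    by metis+
  show "snd u = ty1" "snd v = ty1" by (fact ty)+
  have two: "holds \<rho> \<kappa> [b, a] (bind 1 u (bind 0 v A)) \<longleftrightarrow> holds (\<rho>(u := a, v := b)) \<kappa> [] A"
    if A: "wff {} [] A" for A u v
  proof -
    have "wff {} [snd v] (bind 0 v A)"
      using wff_bind[OF A, of v] by simp
    then show ?thesis
      using holds_bind[of "{}" "[snd v]" "bind 0 v A" "[b]" \<rho> \<kappa> a u]
        holds_bind[OF A, of "[]" "\<rho>(u := a)" \<kappa> b v] by (simp del: fun_upd_apply)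
  qed
  show "holds (\<rho>(u := a, v := b)) \<kappa> [] q2 \<longleftrightarrow> holds (\<rho>(vf := a, vx := b)) \<kappa> [] (RT2_matrix k)"
    using two[OF q2, of u v] two[OF wff_RT2_matrix, of vf vx k] * by simp
qed

text \<open>Only singletons occur as inputs, so a finite part of \<open>rep f\<close> speaks about
  finitely many values of \<open>f\<close>; this links Scott continuity to continuity on Baire
  space.\<close>

definition rep :: "(nat \<Rightarrow> nat) \<Rightarrow> nat set" where
  "rep f = range (\<lambda>n. prod_encode (set_encode {n}, f n))"

lemma app_rep: "app (rep f) {n} = {f n}"
proof (intro equalityI subsetI)
  fix k assume "k \<in> app (rep f) {n}"
  then obtain e m where e: "finite e" "e \<subseteq> {n}" and "prod_encode (set_encode e, k) = prod_encode (set_encode {m}, f m)"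
    unfolding app_def rep_def by blast
  then have "set_encode e = set_encode {m}" "k = f m"
    unfolding prod_encode_eq by simp_all
  moreover from this(1) have "e = {m}"
    using set_encode_eq[of e "{m}"] e(1) by (simp del: set_encode_insert)
  ultimately show "k \<in> {f n}"
    using e(2) by simp
next
  fix k assume "k \<in> {f n}"
  then have "prod_encode (set_encode {n}, k) \<in> rep f"
    unfolding rep_def by blast
  then show "k \<in> app (rep f) {n}"
    unfolding app_def by (intro CollectI exI[of _ "{n}"]) simp
qed

lemma per_rep: "per ty1 (rep f) (rep f)"
  by (auto simp: app_rep)

lemma rep_finite:
  assumes "finite e" "e \<subseteq> rep f"
  shows "\<exists>k. \<forall>f'. agree k f f' \<longrightarrow> e \<subseteq> rep f'"
proof -
  obtain N where N: "finite N" "e = (\<lambda>n. prod_encode (set_encode {n}, f n)) ` N"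
    using assms finite_subset_image unfolding rep_def by (metis (no_types, lifting))
  obtain k where k: "\<forall>n\<in>N. n < k"
    using N(1) finite_nat_set_iff_bounded by blast
  have "e \<subseteq> rep f'" if "agree k f f'" for f'
  proof -
    have "e = (\<lambda>n. prod_encode (set_encode {n}, f' n)) ` N"
      unfolding N(2) using that k by (intro image_cong) (simp_all add: agree_def)
    then show ?thesis
      unfolding rep_def by blast
  qed
  then show ?thesis by blast
qed

fun zero_of :: "ty \<Rightarrow> nat set" where
  "zero_of Nt = {0}"
| "zero_of (Fn \<rho> \<tau>) = app kC (zero_of \<tau>)"

lemma per_zero_of: "per \<tau> (zero_of \<tau>) (zero_of \<tau>)"
  by (induction \<tau>) (auto simp: app_kC)

text \<open>Variables other than \<open>u\<close> receive fixed total defaults, so that the terms of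
  a typical use denote functions of \<open>f\<close> and \<open>y\<close> alone.\<close>

definition val :: "var \<Rightarrow> (nat \<Rightarrow> nat) \<Rightarrow> var \<Rightarrow> nat set" where
  "val u f = (\<lambda>x. zero_of (snd x))(u := rep f)"

definition cval :: "(nat \<Rightarrow> nat) \<Rightarrow> ty \<Rightarrow> nat set" where
  "cval y = zero_of(ty1 := rep y)"

lemma total_val_val: "snd u = ty1 \<Longrightarrow> total_val (val u f)"
  unfolding val_def by (rule total_val_upd) (simp_all add: total_val_def per_zero_of per_rep del: per.simps)

lemma total_cst_cval: "total_cst (cval y)"
  by (simp add: cval_def per_zero_of per_rep del: per.simps)

definition denote :: "var \<Rightarrow> trm \<Rightarrow> (nat \<Rightarrow> nat) \<Rightarrow> (nat \<Rightarrow> nat) \<Rightarrow> nat \<Rightarrow> nat" where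
  "denote u t f y n = the_elem (app (ev (val u f) (cval y) [] t) {n})"

lemma app_ev_denote:
  assumes "snd u = ty1" "tyof [] t = Some ty1"
  shows "app (ev (val u f) (cval y) [] t) {n} = {denote u t f y n}"
proof -
  have "per ty1 (ev (val u f) (cval y) [] t) (ev (val u f) (cval y) [] t)"
    using assms by (intro ev_total total_val_val total_cst_cval) simp_all
  then have "per Nt (app (ev (val u f) (cval y) [] t) {n}) (app (ev (val u f) (cval y) [] t) {n})"
    by (rule per.simps(2)[THEN iffD1, rule_format]) simp
  then obtain m where "app (ev (val u f) (cval y) [] t) {n} = {m}"
    by (simp only: per.simps) blast
  then show ?thesis
    by (simp add: denote_def)
qed

text \<open>Scott continuity is applied to one argument at a time: a finite part of
  \<open>rep f\<close> suffices with \<open>rep y\<close> intact, and then a finite part of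
  \<open>rep y\<close>. By \<open>rep_finite\<close> initial segments secure both parts, and a
  singleton that keeps its element cannot change.\<close>

lemma denote_continuous:
  assumes "snd u = ty1" "tyof [] t = Some ty1"
  shows "\<exists>k. \<forall>f' y'. agree k f f' \<longrightarrow> agree k y y' \<longrightarrow> denote u t f' y' n = denote u t f y n"
proof -
  define \<phi> where "\<phi> X Y = app (ev ((\<lambda>x. zero_of (snd x))(u := X)) (zero_of(ty1 := Y)) [] t) {n}" for X Y
  have \<phi>: "\<phi> (rep f) (rep y) = {denote u t f y n}" for f y
    using app_ev_denote[OF assms] by (simp add: \<phi>_def val_def cval_def)
  have s1: "scott (\<lambda>X. \<phi> X Y)" for Y
    unfolding \<phi>_def by (intro scott_app scott_ev_var scott_const)
  have s2: "scott (\<lambda>Y. \<phi> X Y)" for X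
    unfolding \<phi>_def by (intro scott_app scott_ev_cst scott_const)
  obtain d where d: "finite d" "d \<subseteq> rep f" "denote u t f y n \<in> \<phi> d (rep y)"
    using scott_finite[OF s1[of "rep y"], of "denote u t f y n" "rep f"] \<phi> by auto
  obtain e where e: "finite e" "e \<subseteq> rep y" "denote u t f y n \<in> \<phi> d e"
    using scott_finite[OF s2 d(3)] by blast
  obtain k l where k: "\<And>f'. agree k f f' \<Longrightarrow> d \<subseteq> rep f'" and l: "\<And>y'. agree l y y' \<Longrightarrow> e \<subseteq> rep y'"
    using rep_finite[OF d(1,2)] rep_finite[OF e(1,2)] by blast
  have "denote u t f' y' n = denote u t f y n" if "agree (max k l) f f'" "agree (max k l) y y'" for f' y'
  proof -
    have "d \<subseteq> rep f'" "e \<subseteq> rep y'"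
      using that k l agree_mono by (meson max.cobounded1 max.cobounded2)+
    then have "denote u t f y n \<in> \<phi> (rep f') (rep y')"
      using e(3) scott_mono[OF s1, of d "rep f'" e] scott_mono[OF s2, of e "rep y'" "rep f'"] by blast
    then show ?thesis
      by (simp add: \<phi>)
  qed
  then show ?thesis by blast
qed

lemma ev_no_csts: "csts t = {} \<Longrightarrow> ev \<rho> \<kappa> es t = ev \<rho> \<kappa>' es t"
  by (induction t) auto

theorem theorem3p1:
  shows "\<not> one_typical_use iRCA0\<omega> (RT2 4) (RT2 2)"
proof
  assume "one_typical_use iRCA0\<omega> (RT2 4) (RT2 2)"
  then obtain u v q1 q2 x y p1 p2 r s where
    q2: "wff {} [] q2" "u \<noteq> v" and Q: "RT2 4 = Forall u (Imp q1 (Exists v q2))" and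
    p2: "wff {} [] p2" "x \<noteq> y" and P: "RT2 2 = Forall x (Imp p1 (Exists y p2))" and
    r: "wt {} [] r (snd x)" and s: "wt {snd y} [] s (snd v)" and
    ded: "deduces iRCA0\<omega> {snd y} ({u} \<union> fv r \<union> fv s)
         {subst x r (subst y (Cst (snd y)) p2)} (subst v s q2)"
    unfolding one_typical_use_def by - (elim exE conjE, rule that)
  note Q' = typical_formula_matrix[OF Q q2] and P' = typical_formula_matrix[OF P p2]
  have rt: "tyof [] r = Some ty1" "csts r = {}" and st: "tyof [] s = Some ty1"
    using r s P'(1) Q'(2) by (simp_all add: wt_def)
  have ct: "tyof [] (Cst ty1) = Some ty1" by simp
  \<comment> \<open>\<open>r\<close> contains no constants, so the zero function is a mere
    placeholder for the value of the fresh constant, as \<open>r_ev\<close> confirms.\<close>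
  define F where "F f = denote u r f (\<lambda>_. 0)" for f
  define S where "S f z = denote u s f z 0" for f z
  have r_ev: "app (ev (val u f) (cval z) [] r) {n} = {F f n}" for f z n
    using app_ev_denote[OF Q'(1) rt(1)] ev_no_csts[OF rt(2)] unfolding F_def by metis
  interpret reduction F S
  proof
    show "\<exists>k. \<forall>f'. agree k f f' \<longrightarrow> F f' n = F f n" for f n
      using denote_continuous[OF Q'(1) rt(1), of f "\<lambda>_. 0" n] unfolding F_def
      by (metis agree_def)
    show "\<exists>k. \<forall>f' y'. agree k f f' \<longrightarrow> agree k y y' \<longrightarrow> S f' y' = S f y" for f y
      using denote_continuous[OF Q'(1) st] unfolding S_def .
  qed
  obtain f z where z: "homogeneous 2 (F f) z"
    and no: "\<not> (\<exists>w. homogeneous 4 f w \<and> w 0 = S f z)"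
    using no_colour_reduction by blast
  \<comment> \<open>The fresh constant denotes the solution \<open>z\<close>. The claim covers every
    valuation that \<open>soundness\<close> admits; these all give \<open>r\<close> the same value,
    since its variables are protected from generalization.\<close>
  have "holds \<rho> (cval z) [] (subst x r (subst y (Cst (snd y)) p2))"
    if "\<forall>w\<in>{u} \<union> fv r \<union> fv s. \<rho> w = val u f w" for \<rho>
  proof -
    let ?R = "ev (val u f) (cval z) [] r"
    have "ev \<rho> (cval z) [] r = ?R"
      using that by (intro ev_cong) auto
    then have "holds \<rho> (cval z) [] (subst x r (subst y (Cst (snd y)) p2)) \<longleftrightarrow>
      holds (\<rho>(x := ?R, y := rep z)) (cval z) [] p2"
      by (simp add: P'(2) holds_subst[OF rt(1)] holds_subst[OF ct] cval_def del: fun_upd_apply)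
        (simp add: fun_upd_same)
    also have "\<dots> \<longleftrightarrow> holds (\<rho>(vf := ?R, vx := rep z)) (cval z) [] (RT2_matrix 2)"
      by (rule P'(3))
    also have "\<dots> \<longleftrightarrow> homogeneous 2 (F f) z"
      by (rule holds_RT2_matrix) (simp_all add: r_ev app_rep)
    finally show ?thesis using z by simp
  qed
  then have "holds (val u f) (cval z) [] (subst v s q2)"
    using soundness[OF ded total_cst_cval, of "val u f" z "val u f"] total_val_val[OF Q'(1)] by blast
  then have "holds ((val u f)(v := ev (val u f) (cval z) [] s)) (cval z) [] q2"
    by (simp add: holds_subst[OF st])
  \<comment> \<open>\<open>val u f\<close> already maps \<open>u\<close> to \<open>rep f\<close>;
    the update brings the formula into the shape of \<open>typical_formula_matrix\<close>.\<close>
  then have "holds ((val u f)(u := rep f, v := ev (val u f) (cval z) [] s)) (cval z) [] q2"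
    by (simp add: val_def)
  then have "holds ((val u f)(vf := rep f, vx := ev (val u f) (cval z) [] s)) (cval z) [] (RT2_matrix 4)"
    by (simp only: Q'(3))
  then have "homogeneous 4 f (denote u s f z)"
    by (subst (asm) holds_RT2_matrix) (simp_all add: app_rep app_ev_denote[OF Q'(1) st])
  then show False
    using no by (auto simp: S_def)
qed

end
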